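(* Let $\Sigma$ be a complete properly immersed self-expander surface in $\mathbb{R}^3$. If $\Sigma$ has nonpositive scalar curvature and the norm of its second fundamental form is constant, then $\Sigma$ is a plane $\mathbb{R}^2$ through the origin.
   Context: $x$ denotes the position vector. For the (connected) immersed surface $\Sigma$ in $\mathbb{R}^3$, the second fundamental form is $A(X,Y)=(\overline\nabla_XY)^\perp$ ($\overline\nabla$ the Euclidean connection), the mean curvature vector $\mathbf{H}$ is its trace, and $\Sigma$ is a self-expander if $\mathbf{H}=\frac12x^\perp$ ($x^\perp$ the normal component of $x$). The mean curvature $H$ is defined by $\mathbf{H}=-H\mathbf{n}$, $\mathbf{n}$ the unit normal, and the scalar curvature is $Scal_\Sigma=H^2-|A|^2$. $\Sigma$ is properly immersed if the preimage under the immersion of every compact subset of $\mathbb{R}^3$ is compact. *)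

theory Defs
  imports "HOL-Analysis.Analysis"
begin

text \<open>Smoothness is only meant for open sets \<open>S\<close>, where the derivative at a point is unique.\<close>

primrec k_smooth_on :: "nat \<Rightarrow> ('a::real_normed_vector \<Rightarrow> 'b::real_normed_vector) \<Rightarrow> 'a set \<Rightarrow> bool" where
  "k_smooth_on 0 f S \<longleftrightarrow> continuous_on S f"
| "k_smooth_on (Suc k) f S \<longleftrightarrow>
     f differentiable_on S \<and> (\<forall>v. k_smooth_on k (\<lambda>x. frechet_derivative f (at x) v) S)"

definition smooth_on :: "('a::real_normed_vector \<Rightarrow> 'b::real_normed_vector) \<Rightarrow> 'a set \<Rightarrow> bool" where
  "smooth_on f S \<longleftrightarrow> (\<forall>k. k_smooth_on k f S)"

type_synonym 'a chart = "'a set \<times> ('a \<Rightarrow> real^2)"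

definition is_chart :: "'a topology \<Rightarrow> 'a chart \<Rightarrow> bool" where
  "is_chart M = (\<lambda>(U, \<phi>). openin M U \<and> open (\<phi> ` U) \<and>
     homeomorphic_map (subtopology M U) (top_of_set (\<phi> ` U)) \<phi>)"

definition smooth_surface :: "'a topology \<Rightarrow> 'a chart set \<Rightarrow> bool" where
  "smooth_surface M \<A> \<longleftrightarrow>
     Hausdorff_space M \<and> second_countable M \<and>
     (\<forall>c\<in>\<A>. is_chart M c) \<and> \<Union> (fst ` \<A>) = topspace M \<and>
     (\<forall>(U, \<phi>)\<in>\<A>. \<forall>(V, \<psi>)\<in>\<A>. smooth_on (\<psi> \<circ> inv_into U \<phi>) (\<phi> ` (U \<inter> V)))"

text \<open>The expression of \<open>F\<close> in a chart, a map defined on the open set \<open>\<phi> ` U\<close>.\<close>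

definition local_param :: "('a \<Rightarrow> real^3) \<Rightarrow> 'a chart \<Rightarrow> real^2 \<Rightarrow> real^3" where
  "local_param F = (\<lambda>(U, \<phi>). F \<circ> inv_into U \<phi>)"

definition immersion :: "'a chart set \<Rightarrow> ('a \<Rightarrow> real^3) \<Rightarrow> bool" where
  "immersion \<A> F \<longleftrightarrow> (\<forall>c\<in>\<A>. smooth_on (local_param F c) (snd c ` fst c) \<and>
     (\<forall>u \<in> snd c ` fst c. inj (frechet_derivative (local_param F c) (at u))))"

definition properly_immersed :: "'a topology \<Rightarrow> ('a \<Rightarrow> real^3) \<Rightarrow> bool" where
  "properly_immersed M F \<longleftrightarrow> (\<forall>K. compact K \<longrightarrow> compactin M {p \<in> topspace M. F p \<in> K})"

text \<open>
  Lengths of piecewise \<open>C\<^sup>1\<close> curves in the metric induced by the immersion: the induced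
  norm of \<open>\<gamma>'\<close> is the Euclidean norm of \<open>(F \<circ> \<gamma>)'\<close>. The library's notion of piecewise \<open>C\<^sup>1\<close>
  does not bound the derivative near the breakpoints, so integrability of the speed must be required
  separately (otherwise a curve of infinite length would get the default value 0).
\<close>

definition curve_lengths :: "'a topology \<Rightarrow> ('a \<Rightarrow> real^3) \<Rightarrow> 'a \<Rightarrow> 'a \<Rightarrow> real set" where
  "curve_lengths M F p q =
     {integral {0..1} (\<lambda>t. norm (vector_derivative (F \<circ> \<gamma>) (at t))) | \<gamma>.
        pathin M \<gamma> \<and> \<gamma> 0 = p \<and> \<gamma> 1 = q \<and>
        (F \<circ> \<gamma>) piecewise_C1_differentiable_on {0..1} \<and>
        (\<lambda>t. norm (vector_derivative (F \<circ> \<gamma>) (at t))) integrable_on {0..1}}"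

definition intrinsic_dist :: "'a topology \<Rightarrow> ('a \<Rightarrow> real^3) \<Rightarrow> 'a \<Rightarrow> 'a \<Rightarrow> real" where
  "intrinsic_dist M F p q =
     (if p \<in> topspace M \<and> q \<in> topspace M then Inf (curve_lengths M F p q) else 0)"

definition complete_surface :: "'a topology \<Rightarrow> ('a \<Rightarrow> real^3) \<Rightarrow> bool" where
  "complete_surface M F \<longleftrightarrow> Metric_space.mcomplete (topspace M) (intrinsic_dist M F)"

text \<open>
  Geometry of a parametrised immersed surface \<open>f\<close> at the parameter \<open>u\<close>. The unit normal is determined
  only up to sign, here fixed by the orientation of the parameter domain; the quantities
  that enter the theorem do not depend on this sign.
\<close>

definition coord_tangent :: "(real^2 \<Rightarrow> real^3) \<Rightarrow> real^2 \<Rightarrow> 2 \<Rightarrow> real^3" where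
  "coord_tangent f u i = frechet_derivative f (at u) (axis i 1)"

definition unit_normal :: "(real^2 \<Rightarrow> real^3) \<Rightarrow> real^2 \<Rightarrow> real^3" where
  "unit_normal f u = sgn (cross3 (coord_tangent f u 1) (coord_tangent f u 2))"

definition normal_part :: "(real^2 \<Rightarrow> real^3) \<Rightarrow> real^2 \<Rightarrow> real^3 \<Rightarrow> real^3" where
  "normal_part f u v = (v \<bullet> unit_normal f u) *\<^sub>R unit_normal f u"

definition induced_metric :: "(real^2 \<Rightarrow> real^3) \<Rightarrow> real^2 \<Rightarrow> real^2^2" where
  "induced_metric f u = (\<chi> i j. coord_tangent f u i \<bullet> coord_tangent f u j)"

abbreviation inverse_metric :: "(real^2 \<Rightarrow> real^3) \<Rightarrow> real^2 \<Rightarrow> real^2^2" where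
  "inverse_metric f u \<equiv> matrix_inv (induced_metric f u)"

text \<open>
  Tangent vector fields are given by their coordinate expressions \<open>X\<close>, \<open>Y\<close> in the parameter domain;
  the Euclidean connection differentiates the field \<open>df(Y)\<close> along the surface in direction \<open>X\<close>.
\<close>

definition second_fundamental_form ::
  "(real^2 \<Rightarrow> real^3) \<Rightarrow> (real^2 \<Rightarrow> real^2) \<Rightarrow> (real^2 \<Rightarrow> real^2) \<Rightarrow> real^2 \<Rightarrow> real^3" where
  "second_fundamental_form f X Y u =
     normal_part f u (frechet_derivative (\<lambda>v. frechet_derivative f (at v) (Y v)) (at u) (X u))"

definition sff_coord :: "(real^2 \<Rightarrow> real^3) \<Rightarrow> real^2 \<Rightarrow> 2 \<Rightarrow> 2 \<Rightarrow> real^3" where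
  "sff_coord f u i j = second_fundamental_form f (\<lambda>_. axis i 1) (\<lambda>_. axis j 1) u"

definition mean_curvature_vector :: "(real^2 \<Rightarrow> real^3) \<Rightarrow> real^2 \<Rightarrow> real^3" where
  "mean_curvature_vector f u =
     (\<Sum>i\<in>UNIV. \<Sum>j\<in>UNIV. inverse_metric f u $ i $ j *\<^sub>R sff_coord f u i j)"

text \<open>The mean curvature \<open>H\<close> is the coefficient in \<open>\<^bold>H = - H \<^bold>n\<close>.\<close>

definition mean_curvature :: "(real^2 \<Rightarrow> real^3) \<Rightarrow> real^2 \<Rightarrow> real" where
  "mean_curvature f u = - (mean_curvature_vector f u \<bullet> unit_normal f u)"

definition sff_norm :: "(real^2 \<Rightarrow> real^3) \<Rightarrow> real^2 \<Rightarrow> real" where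
  "sff_norm f u =
     sqrt (\<Sum>i\<in>UNIV. \<Sum>j\<in>UNIV. \<Sum>k\<in>UNIV. \<Sum>l\<in>UNIV.
       inverse_metric f u $ i $ k * inverse_metric f u $ j $ l *
       (sff_coord f u i j \<bullet> sff_coord f u k l))"

definition scalar_curvature :: "(real^2 \<Rightarrow> real^3) \<Rightarrow> real^2 \<Rightarrow> real" where
  "scalar_curvature f u = (mean_curvature f u)\<^sup>2 - (sff_norm f u)\<^sup>2"

definition self_expander :: "'a chart set \<Rightarrow> ('a \<Rightarrow> real^3) \<Rightarrow> bool" where
  "self_expander \<A> F \<longleftrightarrow> (\<forall>c\<in>\<A>. \<forall>u \<in> snd c ` fst c.
     mean_curvature_vector (local_param F c) u =
       (1/2) *\<^sub>R normal_part (local_param F c) u (local_param F c u))"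

definition nonpos_scalar_curvature :: "'a chart set \<Rightarrow> ('a \<Rightarrow> real^3) \<Rightarrow> bool" where
  "nonpos_scalar_curvature \<A> F \<longleftrightarrow> (\<forall>c\<in>\<A>. \<forall>u \<in> snd c ` fst c.
     scalar_curvature (local_param F c) u \<le> 0)"

definition constant_sff_norm :: "'a chart set \<Rightarrow> ('a \<Rightarrow> real^3) \<Rightarrow> bool" where
  "constant_sff_norm \<A> F \<longleftrightarrow> (\<exists>a. \<forall>c\<in>\<A>. \<forall>u \<in> snd c ` fst c.
     sff_norm (local_param F c) u = a)"

end

theory Submission
  imports Defs
begin

text \<open>
By properness some point of the surface is closest to the origin. There the position vector is
normal, and this one point already shows that the constant \<open>|A|\<close> is zero. Indeed, differentiating the
self-expander equation \<open>\<^bold>H = x\<^sup>\<bottom> / 2\<close> shows that the gradient of \<open>H\<close> is, up to the factor \<open>1/2\<close> and a sign, the shape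
operator applied to the tangential part of \<open>x\<close>, so it vanishes at the closest point, and
the gradient of the constant \<open>|A|\<^sup>2\<close> vanishes too. With the Codazzi equations this gives \<open>\<nabla>A = 0\<close> at the closest
point, unless that point is umbilic, and at an umbilic point nonpositive scalar curvature forces \<open>A = 0\<close>.
On the other hand, the identity of Simons for a self-expander with constant \<open>|A|\<close> reads
\<open>|\<nabla>A|\<^sup>2 = (|A|\<^sup>2 + 1/2) |A|\<^sup>2\<close>. Hence \<open>A = 0\<close> at the closest point, and so everywhere
(\<open>expander_graph_sff_norm_zero\<close>, \<open>expander_sff_norm_zero_at_critical_point\<close>).

The computation needs the identity of Simons only at one point, where the tangent plane can be taken as
parameter plane. The surface is written there as the graph of a function \<open>w\<close>, and the identity is
obtained by differentiating the formulas for the mean and the Gauss curvature of a graph twice. Instead of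
reparametrising, \<open>w\<close> is differentiated along the coordinate fields of the projection to the tangent
plane, which commute (\<open>lie_commute\<close>).

When \<open>A = 0\<close>, also \<open>x\<^sup>\<bottom> = 0\<close>, so each point has a neighbourhood that is mapped into a plane through the origin
(\<open>flat_expander_locally_in_plane\<close>). By connectedness it is the same plane for all points
(\<open>locally_planar_imp_planar\<close>). The immersion is then a proper local homeomorphism from a connected
space onto a plane, which is simply connected, and such a map is a homeomorphism
(\<open>homeomorphic_map_euclidean\<close>).
\<close>

section \<open>Calculus of smooth functions\<close>

lemma k_smooth_on_Suc_imp:
  assumes "k_smooth_on (Suc k) f S"
  shows "k_smooth_on k f S"
  using assms
proof (induction k arbitrary: f)
  case 0
  then show ?case by (simp add: differentiable_imp_continuous_on)
next
  case (Suc k)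
  then show ?case by auto
qed

lemma frechet_derivative_cong_open:
  assumes "open S" "x \<in> S" "\<And>y. y \<in> S \<Longrightarrow> f y = g y"
  shows "frechet_derivative f (at x) = frechet_derivative g (at x)"
proof -
  have "(f has_derivative D) (at x) \<longleftrightarrow> (g has_derivative D) (at x)" for D
    using assms has_derivative_transform_within_open[of f D x UNIV S g]
      has_derivative_transform_within_open[of g D x UNIV S f] by auto
  then show ?thesis by (simp add: frechet_derivative_def)
qed

lemma k_smooth_on_cong:
  assumes "open S" "\<And>y. y \<in> S \<Longrightarrow> f y = g y"
  shows "k_smooth_on k f S \<longleftrightarrow> k_smooth_on k g S"
  using assms(2)
proof (induction k arbitrary: f g)
  case 0
  then show ?case by (simp cong: continuous_on_cong)
next
  case (Suc k)
  have "f differentiable_on S \<longleftrightarrow> g differentiable_on S"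
    unfolding differentiable_on_def using Suc.prems
    by (metis differentiable_transform_within zero_less_one)
  moreover have "k_smooth_on k (\<lambda>x. frechet_derivative f (at x) v) S \<longleftrightarrow>
      k_smooth_on k (\<lambda>x. frechet_derivative g (at x) v) S" for v
    by (rule Suc.IH) (use frechet_derivative_cong_open[OF assms(1) _ Suc.prems] in auto)
  ultimately show ?case by simp
qed

lemma smooth_on_cong:
  assumes "open S" "\<And>y. y \<in> S \<Longrightarrow> f y = g y"
  shows "smooth_on f S \<longleftrightarrow> smooth_on g S"
  using k_smooth_on_cong[OF assms] by (simp add: smooth_on_def)

lemma smooth_on_subset:
  assumes "smooth_on f S" "T \<subseteq> S"
  shows "smooth_on f T"
proof -
  have "k_smooth_on k f S \<Longrightarrow> k_smooth_on k f T" for k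
  proof (induction k arbitrary: f)
    case 0
    then show ?case using assms(2) by (auto intro: continuous_on_subset)
  next
    case (Suc k)
    then show ?case using assms(2) by (auto intro: differentiable_on_subset)
  qed
  then show ?thesis using assms(1) by (auto simp: smooth_on_def)
qed

lemma smooth_on_differentiable:
  assumes "smooth_on f S" "open S" "x \<in> S"
  shows "f differentiable (at x)"
proof -
  have "k_smooth_on (Suc 0) f S" using assms(1) unfolding smooth_on_def by blast
  then show ?thesis using assms(2,3) by (auto simp: differentiable_on_eq_differentiable_at)
qed

lemma smooth_on_continuous_on: "smooth_on f S \<Longrightarrow> continuous_on S f"
  unfolding smooth_on_def using k_smooth_on.simps(1) by metis

lemma smooth_on_frechet_derivative:
  assumes "smooth_on f S"
  shows "smooth_on (\<lambda>x. frechet_derivative f (at x) v) S"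
  using assms unfolding smooth_on_def by (metis k_smooth_on.simps(2))

lemma k_smooth_on_const: "k_smooth_on k (\<lambda>x. c) S"
  by (induction k arbitrary: c) auto

lemma smooth_on_const: "smooth_on (\<lambda>x. c) S"
  by (simp add: smooth_on_def k_smooth_on_const)

lemma has_frechet_derivative:
  "f differentiable (at x) \<Longrightarrow> (f has_derivative frechet_derivative f (at x)) (at x)"
  by (simp add: frechet_derivative_works)

lemma frechet_derivative_eqI: "(f has_derivative D) (at x) \<Longrightarrow> frechet_derivative f (at x) = D"
  by (metis frechet_derivative_at)

lemma frechet_derivative_add:
  assumes "f differentiable (at x)" "g differentiable (at x)"
  shows "frechet_derivative (\<lambda>x. f x + g x) (at x) v =
    frechet_derivative f (at x) v + frechet_derivative g (at x) v"
  using frechet_derivative_eqI[OF has_derivative_add[OF assms[THEN has_frechet_derivative]]] by simp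

lemma frechet_derivative_diff:
  assumes "f differentiable (at x)" "g differentiable (at x)"
  shows "frechet_derivative (\<lambda>x. f x - g x) (at x) v =
    frechet_derivative f (at x) v - frechet_derivative g (at x) v"
  using frechet_derivative_eqI[OF has_derivative_diff[OF assms[THEN has_frechet_derivative]]] by simp

lemma frechet_derivative_mult:
  fixes f g :: "'a::real_normed_vector \<Rightarrow> real"
  assumes "f differentiable (at x)" "g differentiable (at x)"
  shows "frechet_derivative (\<lambda>x. f x * g x) (at x) v =
    f x * frechet_derivative g (at x) v + frechet_derivative f (at x) v * g x"
  using frechet_derivative_eqI[OF has_derivative_mult[OF assms[THEN has_frechet_derivative]]] by simp

lemma frechet_derivative_linear:
  assumes "bounded_linear L" "f differentiable (at x)"
  shows "frechet_derivative (\<lambda>x. L (f x)) (at x) v = L (frechet_derivative f (at x) v)"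
  using frechet_derivative_eqI[OF bounded_linear.has_derivative[OF assms(1)
        has_frechet_derivative[OF assms(2)]]] by simp

lemma frechet_derivative_inverse:
  fixes f :: "'a::real_normed_vector \<Rightarrow> real"
  assumes "f differentiable (at x)" "f x \<noteq> 0"
  shows "frechet_derivative (\<lambda>x. inverse (f x)) (at x) v =
    - 1 * (frechet_derivative f (at x) v * (inverse (f x) * inverse (f x)))"
  using frechet_derivative_eqI[OF Deriv.has_derivative_inverse[OF assms(2)
        has_frechet_derivative[OF assms(1)]]] by simp

lemma k_smooth_on_SucD:
  assumes "k_smooth_on (Suc k) f S" "open S"
  shows "\<And>x. x \<in> S \<Longrightarrow> f differentiable (at x)"
    and "k_smooth_on k (\<lambda>x. frechet_derivative f (at x) v) S"
  using assms by (auto simp: differentiable_on_eq_differentiable_at)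

lemma k_smooth_on_SucI:
  assumes "open S" "\<And>x. x \<in> S \<Longrightarrow> f differentiable (at x)"
    and "\<And>v. k_smooth_on k (f' v) S"
    and "\<And>v x. x \<in> S \<Longrightarrow> frechet_derivative f (at x) v = f' v x"
  shows "k_smooth_on (Suc k) f S"
  using assms(2,3) k_smooth_on_cong[OF assms(1,4)] assms(1)
  by (auto simp: differentiable_on_eq_differentiable_at)

lemma k_smooth_on_add:
  assumes "open S" "k_smooth_on k f S" "k_smooth_on k g S"
  shows "k_smooth_on k (\<lambda>x. f x + g x) S"
  using assms(2,3)
proof (induction k arbitrary: f g)
  case 0
  then show ?case by (auto intro: continuous_intros)
next
  case (Suc k)
  note d = k_smooth_on_SucD(1)[OF _ assms(1)]
  show ?case
  proof (rule k_smooth_on_SucI[OF assms(1)])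
    show "k_smooth_on k (\<lambda>x. frechet_derivative f (at x) v + frechet_derivative g (at x) v) S" for v
      using Suc k_smooth_on_SucD(2)[OF _ assms(1)] by blast
  qed (use d[OF Suc.prems(1)] d[OF Suc.prems(2)] in \<open>auto intro: frechet_derivative_add\<close>)
qed

lemma k_smooth_on_mult:
  fixes f g :: "'a::real_normed_vector \<Rightarrow> real"
  assumes "open S" "k_smooth_on k f S" "k_smooth_on k g S"
  shows "k_smooth_on k (\<lambda>x. f x * g x) S"
  using assms(2,3)
proof (induction k arbitrary: f g)
  case 0
  then show ?case by (auto intro: continuous_intros)
next
  case (Suc k)
  note d = k_smooth_on_SucD(1)[OF _ assms(1)]
  show ?case
  proof (rule k_smooth_on_SucI[OF assms(1)])
    show "k_smooth_on k (\<lambda>x. f x * frechet_derivative g (at x) v + frechet_derivative f (at x) v * g x) S" for v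
      using Suc k_smooth_on_SucD(2)[OF _ assms(1)] k_smooth_on_Suc_imp
      by (intro k_smooth_on_add[OF assms(1)]) blast+
  qed (use d[OF Suc.prems(1)] d[OF Suc.prems(2)] in \<open>auto intro: frechet_derivative_mult\<close>)
qed

lemma k_smooth_on_inverse:
  fixes f :: "'a::real_normed_vector \<Rightarrow> real"
  assumes "open S" "k_smooth_on k f S" "\<And>x. x \<in> S \<Longrightarrow> f x \<noteq> 0"
  shows "k_smooth_on k (\<lambda>x. inverse (f x)) S"
  using assms(2)
proof (induction k)
  case 0
  then show ?case using assms(3) by (auto intro!: continuous_intros)
next
  case (Suc k)
  note d = k_smooth_on_SucD(1)[OF Suc.prems assms(1)]
  have i: "k_smooth_on k (\<lambda>x. inverse (f x)) S"
    using Suc k_smooth_on_Suc_imp by blast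
  show ?case
  proof (rule k_smooth_on_SucI[OF assms(1)])
    show "k_smooth_on k (\<lambda>x. - 1 * (frechet_derivative f (at x) v * (inverse (f x) * inverse (f x)))) S" for v
      by (intro k_smooth_on_mult[OF assms(1)] i k_smooth_on_const k_smooth_on_SucD(2)[OF Suc.prems assms(1)])
  qed (use d assms(3) in \<open>auto simp: frechet_derivative_inverse intro: differentiable_inverse\<close>)
qed

lemma k_smooth_on_linear:
  assumes "open S" "bounded_linear L" "k_smooth_on k f S"
  shows "k_smooth_on k (\<lambda>x. L (f x)) S"
  using assms(3)
proof (induction k arbitrary: f)
  case 0
  then show ?case using assms(2) by (auto intro: bounded_linear.continuous_on)
next
  case (Suc k)
  note d = k_smooth_on_SucD(1)[OF Suc.prems assms(1)]
  show ?case
  proof (rule k_smooth_on_SucI[OF assms(1)])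
    show "k_smooth_on k (\<lambda>x. L (frechet_derivative f (at x) v)) S" for v
      using Suc k_smooth_on_SucD(2)[OF _ assms(1)] by blast
    show "(\<lambda>x. L (f x)) differentiable (at x)" if "x \<in> S" for x
      using bounded_linear.has_derivative[OF assms(2) has_frechet_derivative[OF d[OF that]]]
      by (rule differentiableI)
  qed (use d assms(2) in \<open>simp add: frechet_derivative_linear\<close>)
qed

lemma smooth_on_add: "open S \<Longrightarrow> smooth_on f S \<Longrightarrow> smooth_on g S \<Longrightarrow> smooth_on (\<lambda>x. f x + g x) S"
  by (simp add: smooth_on_def k_smooth_on_add)

lemma smooth_on_mult:
  fixes f g :: "'a::real_normed_vector \<Rightarrow> real"
  shows "open S \<Longrightarrow> smooth_on f S \<Longrightarrow> smooth_on g S \<Longrightarrow> smooth_on (\<lambda>x. f x * g x) S"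
  by (simp add: smooth_on_def k_smooth_on_mult)

lemma smooth_on_inverse:
  fixes f :: "'a::real_normed_vector \<Rightarrow> real"
  shows "open S \<Longrightarrow> smooth_on f S \<Longrightarrow> (\<And>x. x \<in> S \<Longrightarrow> f x \<noteq> 0) \<Longrightarrow> smooth_on (\<lambda>x. inverse (f x)) S"
  by (simp add: smooth_on_def k_smooth_on_inverse)

lemma smooth_on_linear:
  "open S \<Longrightarrow> bounded_linear L \<Longrightarrow> smooth_on f S \<Longrightarrow> smooth_on (\<lambda>x. L (f x)) S"
  by (simp add: smooth_on_def k_smooth_on_linear)

lemma smooth_on_minus: "open S \<Longrightarrow> smooth_on f S \<Longrightarrow> smooth_on (\<lambda>x. - f x) S"
  by (rule smooth_on_linear[OF _ bounded_linear_minus[OF bounded_linear_ident]])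

lemma smooth_on_diff: "open S \<Longrightarrow> smooth_on f S \<Longrightarrow> smooth_on g S \<Longrightarrow> smooth_on (\<lambda>x. f x - g x) S"
  using smooth_on_add[OF _ _ smooth_on_minus, of S f g] by simp

lemma has_real_derivative_along_line:
  fixes f :: "'a::real_normed_vector \<Rightarrow> real"
  assumes "f differentiable (at (x + s *\<^sub>R v))"
  shows "((\<lambda>s. f (x + s *\<^sub>R v)) has_real_derivative frechet_derivative f (at (x + s *\<^sub>R v)) v) (at s)"
proof -
  let ?D = "frechet_derivative f (at (x + s *\<^sub>R v))"
  have "((\<lambda>s. x + s *\<^sub>R v) has_derivative (\<lambda>h. h *\<^sub>R v)) (at s)"
    by (auto intro!: derivative_eq_intros)
  from has_derivative_compose[OF this has_frechet_derivative[OF assms]]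
  have "((\<lambda>s. f (x + s *\<^sub>R v)) has_derivative (\<lambda>h. ?D (h *\<^sub>R v))) (at s)" .
  moreover have "?D (h *\<^sub>R v) = ?D v * h" for h
    using linear_cmul[OF linear_frechet_derivative[OF assms]] by simp
  ultimately show ?thesis by (simp add: has_field_derivative_def fun_eq_iff)
qed

lemma second_difference_mean_value:
  fixes f :: "'a::real_normed_vector \<Rightarrow> real"
  assumes S: "open S" and f: "\<And>y. y \<in> S \<Longrightarrow> f differentiable (at y)"
    and fv: "\<And>y. y \<in> S \<Longrightarrow> (\<lambda>y. frechet_derivative f (at y) v) differentiable (at y)"
    and t: "t > 0" and in_S: "\<And>a b. a \<in> {0..t} \<Longrightarrow> b \<in> {0..t} \<Longrightarrow> x + a *\<^sub>R v + b *\<^sub>R w \<in> S"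
  obtains a b where "a \<in> {0..t}" "b \<in> {0..t}"
    "f (x + t *\<^sub>R v + t *\<^sub>R w) - f (x + t *\<^sub>R v) - f (x + t *\<^sub>R w) + f x =
      t * t * frechet_derivative (\<lambda>y. frechet_derivative f (at y) v) (at (x + a *\<^sub>R v + b *\<^sub>R w)) w"
proof -
  let ?f' = "\<lambda>y. frechet_derivative f (at y) v"
  have in_S': "x + b *\<^sub>R w + a *\<^sub>R v \<in> S" if "a \<in> {0..t}" "b \<in> {0..t}" for a b
    using in_S[OF that] by (simp add: algebra_simps)
  have in_S0: "x + a *\<^sub>R v \<in> S" if "a \<in> {0..t}" for a
    using in_S[OF that, of 0] t by simp
  let ?p = "\<lambda>s. f (x + t *\<^sub>R w + s *\<^sub>R v) - f (x + s *\<^sub>R v)"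
  have "\<exists>a>0. a < t \<and> ?p t - ?p 0 = (t - 0) * (?f' (x + t *\<^sub>R w + a *\<^sub>R v) - ?f' (x + a *\<^sub>R v))"
    by (rule MVT2[OF t]) (use in_S' in_S0 t in \<open>auto intro!: DERIV_diff has_real_derivative_along_line f\<close>)
  then obtain a where a: "0 < a" "a < t"
    and eq1: "?p t - ?p 0 = t * (?f' (x + t *\<^sub>R w + a *\<^sub>R v) - ?f' (x + a *\<^sub>R v))" by auto
  let ?q = "\<lambda>s. ?f' (x + a *\<^sub>R v + s *\<^sub>R w)"
  have "\<exists>b>0. b < t \<and> ?q t - ?q 0 = (t - 0) * frechet_derivative ?f' (at (x + a *\<^sub>R v + b *\<^sub>R w)) w"
    by (rule MVT2[OF t]) (use in_S a in \<open>auto intro!: has_real_derivative_along_line fv\<close>)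
  then obtain b where b: "0 < b" "b < t"
    and eq2: "?q t - ?q 0 = t * frechet_derivative ?f' (at (x + a *\<^sub>R v + b *\<^sub>R w)) w" by auto
  show ?thesis
  proof (rule that)
    have "?p t - ?p 0 = t * (?q t - ?q 0)" using eq1 by (simp add: algebra_simps)
    then show "f (x + t *\<^sub>R v + t *\<^sub>R w) - f (x + t *\<^sub>R v) - f (x + t *\<^sub>R w) + f x =
      t * t * frechet_derivative ?f' (at (x + a *\<^sub>R v + b *\<^sub>R w)) w"
      using eq2 by (simp add: algebra_simps)
  qed (use a b in auto)
qed

text \<open>
The second difference of \<open>f\<close> over a small parallelogram is symmetric in the two directions, and the
mean value theorem, applied once in each direction, turns it into a value of either mixed derivative
near \<open>x\<close>. Continuity of both mixed derivatives then forces them to agree at \<open>x\<close>.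
\<close>

theorem frechet_derivative_commute:
  fixes f :: "'a::real_normed_vector \<Rightarrow> real"
  assumes S: "open S" "x \<in> S" and f: "smooth_on f S"
  shows "frechet_derivative (\<lambda>y. frechet_derivative f (at y) v) (at x) w =
    frechet_derivative (\<lambda>y. frechet_derivative f (at y) w) (at x) v"
proof (rule ccontr)
  let ?d = "\<lambda>v w y. frechet_derivative (\<lambda>y. frechet_derivative f (at y) v) (at y) w"
  assume ne: "?d v w x \<noteq> ?d w v x"
  define e where "e = \<bar>?d v w x - ?d w v x\<bar> / 2"
  have e: "e > 0" using ne by (simp add: e_def)
  have fd: "f differentiable (at y)" if "y \<in> S" for y
    using smooth_on_differentiable[OF f S(1) that] .
  have fvd: "(\<lambda>y. frechet_derivative f (at y) v) differentiable (at y)" if "y \<in> S" for y v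
    using smooth_on_differentiable[OF smooth_on_frechet_derivative[OF f] S(1) that] .
  have cont: "isCont (?d v w) x" for v w
    using smooth_on_continuous_on[OF smooth_on_frechet_derivative[OF smooth_on_frechet_derivative[OF f]]]
      S by (simp add: continuous_on_eq_continuous_at)
  obtain d1 where d1: "d1 > 0" "\<And>y. dist y x < d1 \<Longrightarrow> \<bar>?d v w y - ?d v w x\<bar> < e"
    using cont[of v w] e unfolding continuous_at_eps_delta dist_real_def by blast
  obtain d2 where d2: "d2 > 0" "\<And>y. dist y x < d2 \<Longrightarrow> \<bar>?d w v y - ?d w v x\<bar> < e"
    using cont[of w v] e unfolding continuous_at_eps_delta dist_real_def by blast
  obtain d3 where d3: "d3 > 0" "ball x d3 \<subseteq> S" using S openE by blast
  define d where "d = min d1 (min d2 d3)"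
  have d: "d > 0" "d \<le> d1" "d \<le> d2" "d \<le> d3" using d1 d2 d3 by (auto simp: d_def)
  define t where "t = d / (2 * (norm v + norm w + 1))"
  have nn: "norm v + norm w + 1 > 0" by (smt (verit) norm_ge_zero)
  have t: "t > 0" using d nn by (simp add: t_def)
  have close: "dist (x + a *\<^sub>R v + b *\<^sub>R w) x < d" if "a \<in> {0..t}" "b \<in> {0..t}" for a b
  proof -
    have "dist (x + a *\<^sub>R v + b *\<^sub>R w) x \<le> norm (a *\<^sub>R v) + norm (b *\<^sub>R w)"
      unfolding dist_norm by (metis add.assoc add_diff_cancel_left' norm_triangle_ineq)
    also have "\<dots> \<le> t * norm v + t * norm w" using that by (auto intro!: add_mono mult_right_mono)
    also have "\<dots> \<le> t * (norm v + norm w + 1)" using t by (simp add: algebra_simps)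
    also have "\<dots> = d / 2"
    proof -
      have "d / (2 * N) * N = d / 2" if "N > 0" for N :: real using that by simp
      from this[OF nn] show ?thesis unfolding t_def .
    qed
    finally show ?thesis using d by simp
  qed
  have close': "dist (x + a *\<^sub>R w + b *\<^sub>R v) x < d" if "a \<in> {0..t}" "b \<in> {0..t}" for a b
    using close[OF that(2,1)] by (simp add: algebra_simps)
  obtain a b where ab: "a \<in> {0..t}" "b \<in> {0..t}"
    "f (x + t *\<^sub>R v + t *\<^sub>R w) - f (x + t *\<^sub>R v) - f (x + t *\<^sub>R w) + f x =
      t * t * ?d v w (x + a *\<^sub>R v + b *\<^sub>R w)"
  proof (rule second_difference_mean_value[OF S(1) fd fvd t])
    show "x + a *\<^sub>R v + b *\<^sub>R w \<in> S" if "a \<in> {0..t}" "b \<in> {0..t}" for a b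
      using close[OF that] d d3 by (auto simp: dist_commute subset_iff)
  qed
  obtain a' b' where ab': "a' \<in> {0..t}" "b' \<in> {0..t}"
    "f (x + t *\<^sub>R w + t *\<^sub>R v) - f (x + t *\<^sub>R w) - f (x + t *\<^sub>R v) + f x =
      t * t * ?d w v (x + a' *\<^sub>R w + b' *\<^sub>R v)"
  proof (rule second_difference_mean_value[OF S(1) fd fvd t])
    show "x + a *\<^sub>R w + b *\<^sub>R v \<in> S" if "a \<in> {0..t}" "b \<in> {0..t}" for a b
      using close'[OF that] d d3 by (auto simp: dist_commute subset_iff)
  qed
  have "t * t * ?d v w (x + a *\<^sub>R v + b *\<^sub>R w) = t * t * ?d w v (x + a' *\<^sub>R w + b' *\<^sub>R v)"
    unfolding ab(3)[symmetric] ab'(3)[symmetric] by (simp add: algebra_simps)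
  then have "?d v w (x + a *\<^sub>R v + b *\<^sub>R w) = ?d w v (x + a' *\<^sub>R w + b' *\<^sub>R v)" using t by simp
  moreover have "\<bar>?d v w (x + a *\<^sub>R v + b *\<^sub>R w) - ?d v w x\<bar> < e"
    by (rule d1(2)) (use close[OF ab(1,2)] d in linarith)
  moreover have "\<bar>?d w v (x + a' *\<^sub>R w + b' *\<^sub>R v) - ?d w v x\<bar> < e"
    by (rule d2(2)) (use close'[OF ab'(1,2)] d in linarith)
  moreover have False if "A = B" "\<bar>A - p\<bar> < \<bar>p - q\<bar> / 2" "\<bar>B - q\<bar> < \<bar>p - q\<bar> / 2" for A B p q :: real
    using that by (auto simp: abs_if split: if_splits)
  ultimately show False unfolding e_def by blast
qed

section \<open>The coordinate fields of a pair of functions\<close>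

definition lie :: "('a \<Rightarrow> 'a) \<Rightarrow> ('a::real_normed_vector \<Rightarrow> real) \<Rightarrow> 'a \<Rightarrow> real" where
  "lie X f x = frechet_derivative f (at x) (X x)"

lemma lie_cong: "open S \<Longrightarrow> x \<in> S \<Longrightarrow> (\<And>y. y \<in> S \<Longrightarrow> f y = g y) \<Longrightarrow> lie X f x = lie X g x"
  unfolding lie_def using frechet_derivative_cong_open[of S x f g] by metis

lemma lie_const [simp]: "lie X (\<lambda>x. c) = (\<lambda>x. 0)"
  by (simp add: lie_def fun_eq_iff)

lemma frechet_derivative_coords:
  fixes f :: "real^2 \<Rightarrow> 'b::real_normed_vector"
  assumes "f differentiable (at x)"
  shows "frechet_derivative f (at x) v =
    (v$1) *\<^sub>R frechet_derivative f (at x) (axis 1 1) + (v$2) *\<^sub>R frechet_derivative f (at x) (axis 2 1)"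
proof -
  have v: "v = (v$1) *\<^sub>R axis 1 1 + (v$2) *\<^sub>R axis 2 1"
    by (simp add: vec_eq_iff forall_2 axis_def)
  note lin = linear_frechet_derivative[OF assms]
  show ?thesis by (subst v) (simp add: linear_add[OF lin] linear_cmul[OF lin])
qed

text \<open>
Near a point where \<open>h1\<close> and \<open>h2\<close> have independent differentials they form a coordinate system, and
\<open>X1\<close>, \<open>X2\<close> are its coordinate fields. Differentiating along these fields replaces partial
derivatives in the new coordinates: every function stays on the original parameter domain, and no
local inverse of \<open>(h1, h2)\<close> has to be formed or shown to be smooth.
\<close>

locale dual_fields =
  fixes S :: "(real^2) set" and X1 X2 :: "real^2 \<Rightarrow> real^2" and h1 h2 :: "real^2 \<Rightarrow> real"
  assumes open_S: "open S"
    and smooth_X: "\<And>i. smooth_on (\<lambda>x. X1 x $ i) S" "\<And>i. smooth_on (\<lambda>x. X2 x $ i) S"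
    and smooth_h: "smooth_on h1 S" "smooth_on h2 S"
    and dual: "\<And>x. x \<in> S \<Longrightarrow> lie X1 h1 x = 1" "\<And>x. x \<in> S \<Longrightarrow> lie X1 h2 x = 0"
      "\<And>x. x \<in> S \<Longrightarrow> lie X2 h1 x = 0" "\<And>x. x \<in> S \<Longrightarrow> lie X2 h2 x = 1"
begin

definition frame_field :: "(real^2 \<Rightarrow> real^2) \<Rightarrow> bool" where
  "frame_field X \<longleftrightarrow> X = X1 \<or> X = X2"

lemma frame_fields [simp]: "frame_field X1" "frame_field X2"
  by (auto simp: frame_field_def)

lemma frame_field_smooth: "frame_field X \<Longrightarrow> smooth_on (\<lambda>x. X x $ i) S"
  using smooth_X by (auto simp: frame_field_def)

lemma diff: "smooth_on f S \<Longrightarrow> x \<in> S \<Longrightarrow> f differentiable (at x)" for f :: "real^2 \<Rightarrow> real"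
  by (rule smooth_on_differentiable[OF _ open_S])

lemma lie_coords:
  assumes "smooth_on f S" "x \<in> S"
  shows "lie X f x = X x $ 1 * lie (\<lambda>_. axis 1 1) f x + X x $ 2 * lie (\<lambda>_. axis 2 1) f x"
  using frechet_derivative_coords[OF diff[OF assms], of "X x"] unfolding lie_def real_scaleR_def .

lemma smooth_lie_const: "smooth_on f S \<Longrightarrow> smooth_on (lie (\<lambda>_. v) f) S"
  unfolding lie_def by (rule smooth_on_frechet_derivative)

lemma smooth_lie:
  assumes "frame_field X" "smooth_on f S"
  shows "smooth_on (lie X f) S"
proof -
  have "smooth_on (\<lambda>x. X x $ 1 * lie (\<lambda>_. axis 1 1) f x + X x $ 2 * lie (\<lambda>_. axis 2 1) f x) S"
    using assms open_S by (intro smooth_on_add smooth_on_mult frame_field_smooth smooth_lie_const) auto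
  then show ?thesis
    using smooth_on_cong[OF open_S lie_coords[OF assms(2), of _ X], of "\<lambda>x. x"] by simp
qed

lemma lie_add:
  "smooth_on f S \<Longrightarrow> smooth_on g S \<Longrightarrow> x \<in> S \<Longrightarrow> lie X (\<lambda>x. f x + g x) x = lie X f x + lie X g x"
  by (simp add: lie_def frechet_derivative_add diff)

lemma lie_diff:
  "smooth_on f S \<Longrightarrow> smooth_on g S \<Longrightarrow> x \<in> S \<Longrightarrow> lie X (\<lambda>x. f x - g x) x = lie X f x - lie X g x"
  by (simp add: lie_def frechet_derivative_diff diff)

lemma lie_mult:
  "smooth_on f S \<Longrightarrow> smooth_on g S \<Longrightarrow> x \<in> S \<Longrightarrow>
    lie X (\<lambda>x. f x * g x) x = f x * lie X g x + lie X f x * g x"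
  by (simp add: lie_def frechet_derivative_mult diff)

lemma lie2_add:
  assumes "smooth_on f S" "smooth_on g S" "x \<in> S" "frame_field Y"
  shows "lie X (lie Y (\<lambda>x. f x + g x)) x = lie X (lie Y f) x + lie X (lie Y g) x"
proof -
  have "lie X (lie Y (\<lambda>x. f x + g x)) x = lie X (\<lambda>x. lie Y f x + lie Y g x) x"
    by (rule lie_cong[OF open_S assms(3)]) (simp add: lie_add assms)
  then show ?thesis using assms by (simp add: lie_add smooth_lie)
qed

lemma lie2_diff:
  assumes "smooth_on f S" "smooth_on g S" "x \<in> S" "frame_field Y"
  shows "lie X (lie Y (\<lambda>x. f x - g x)) x = lie X (lie Y f) x - lie X (lie Y g) x"
proof -
  have "lie X (lie Y (\<lambda>x. f x - g x)) x = lie X (\<lambda>x. lie Y f x - lie Y g x) x"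
    by (rule lie_cong[OF open_S assms(3)]) (simp add: lie_diff assms)
  then show ?thesis using assms by (simp add: lie_diff smooth_lie)
qed

lemma lie2_mult:
  assumes "smooth_on f S" "smooth_on g S" "x \<in> S" "frame_field Y"
  shows "lie X (lie Y (\<lambda>x. f x * g x)) x =
    f x * lie X (lie Y g) x + lie X f x * lie Y g x + lie Y f x * lie X g x + lie X (lie Y f) x * g x"
proof -
  have "lie X (lie Y (\<lambda>x. f x * g x)) x = lie X (\<lambda>x. f x * lie Y g x + lie Y f x * g x) x"
    by (rule lie_cong[OF open_S assms(3)]) (simp add: lie_mult assms)
  then show ?thesis using assms open_S by (simp add: lie_add lie_mult smooth_lie smooth_on_mult)
qed

lemma lie_lie_expand:
  assumes g: "smooth_on g S" and Y: "frame_field Y" and x: "x \<in> S"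
  shows "lie X (lie Y g) x =
    Y x $ 1 * lie X (lie (\<lambda>_. axis 1 1) g) x + lie X (\<lambda>x. Y x $ 1) x * lie (\<lambda>_. axis 1 1) g x +
    (Y x $ 2 * lie X (lie (\<lambda>_. axis 2 1) g) x + lie X (\<lambda>x. Y x $ 2) x * lie (\<lambda>_. axis 2 1) g x)"
proof -
  have "lie X (lie Y g) x =
      lie X (\<lambda>x. Y x $ 1 * lie (\<lambda>_. axis 1 1) g x + Y x $ 2 * lie (\<lambda>_. axis 2 1) g x) x"
    by (rule lie_cong[OF open_S x lie_coords[OF g]])
  then show ?thesis
    using g Y x open_S by (simp add: lie_add lie_mult smooth_on_mult frame_field_smooth smooth_lie_const)
qed

lemma lie_lie_dual:
  assumes Y: "frame_field Y" and x: "x \<in> S"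
  shows "lie X (lie Y h1) x = 0" "lie X (lie Y h2) x = 0"
proof -
  have zero: "lie X (lie Y g) x = 0" if "\<And>y. y \<in> S \<Longrightarrow> lie Y g y = c" for Y g c
  proof -
    have "lie X (lie Y g) x = lie X (\<lambda>_. c) x" by (rule lie_cong[OF open_S x that])
    then show ?thesis by (simp only: lie_const)
  qed
  have "lie X (lie X1 h1) x = 0" "lie X (lie X2 h1) x = 0" "lie X (lie X1 h2) x = 0" "lie X (lie X2 h2) x = 0"
    by (rule zero[OF dual(1)] zero[OF dual(3)] zero[OF dual(2)] zero[OF dual(4)], assumption)+
  then show "lie X (lie Y h1) x = 0" "lie X (lie Y h2) x = 0" using Y by (auto simp: frame_field_def)
qed

text \<open>
The bracket of the two fields is a vector field, and it annihilates \<open>h1\<close> and \<open>h2\<close> because the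
derivatives of these along the fields are constant. Since the differentials of \<open>h1\<close> and \<open>h2\<close>
are independent, the bracket vanishes.
\<close>

lemma lie_commute:
  assumes f: "smooth_on f S" and x: "x \<in> S"
  shows "lie X1 (lie X2 f) x = lie X2 (lie X1 f) x"
proof -
  let ?d1 = "lie (\<lambda>_. axis 1 1)" and ?d2 = "lie (\<lambda>_. axis 2 1)"
  let ?V = "\<lambda>i. lie X1 (\<lambda>x. X2 x $ i) x - lie X2 (\<lambda>x. X1 x $ i) x"
  have sym: "?d1 (?d2 g) x = ?d2 (?d1 g) x" if "smooth_on g S" for g
    using frechet_derivative_commute[OF open_S x that] unfolding lie_def by blast
  have bracket: "lie X1 (lie X2 g) x - lie X2 (lie X1 g) x = ?V 1 * ?d1 g x + ?V 2 * ?d2 g x"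
    if g: "smooth_on g S" for g
  proof -
    have e: "lie X (?d1 g) x = X x $ 1 * ?d1 (?d1 g) x + X x $ 2 * ?d2 (?d1 g) x"
      "lie X (?d2 g) x = X x $ 1 * ?d2 (?d1 g) x + X x $ 2 * ?d2 (?d2 g) x" for X
      using lie_coords[OF smooth_lie_const[OF g] x] sym[OF g] by metis+
    show ?thesis unfolding lie_lie_expand[OF g frame_fields(1) x] lie_lie_expand[OF g frame_fields(2) x] e[of X1] e[of X2]
      by (simp add: algebra_simps)
  qed
  have h: "?V 1 * ?d1 h1 x + ?V 2 * ?d2 h1 x = 0" "?V 1 * ?d1 h2 x + ?V 2 * ?d2 h2 x = 0"
    using bracket[OF smooth_h(1)] bracket[OF smooth_h(2)]
    unfolding lie_lie_dual[OF frame_fields(1) x] lie_lie_dual[OF frame_fields(2) x] by linarith+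
  note d = dual(1)[OF x, unfolded lie_coords[OF smooth_h(1) x, of X1]]
    dual(2)[OF x, unfolded lie_coords[OF smooth_h(2) x, of X1]]
    dual(3)[OF x, unfolded lie_coords[OF smooth_h(1) x, of X2]]
    dual(4)[OF x, unfolded lie_coords[OF smooth_h(2) x, of X2]]
  have "?V 1 = 0 \<and> ?V 2 = 0"
  proof -
    have "V = 0 \<and> W = 0"
      if "x1 * a + x2 * b = 1" "x1 * c + x2 * d = 0" "y1 * a + y2 * b = 0" "y1 * c + y2 * d = 1"
        "V * a + W * b = 0" "V * c + W * d = 0" for x1 x2 y1 y2 a b c d V W :: real
      using that by algebra
    from this[OF d h] show ?thesis .
  qed
  then show ?thesis using bracket[OF f] by simp
qed

end

section \<open>The identity of Simons at a critical point\<close>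

context dual_fields
begin

text \<open>
Here the surface is the graph of \<open>w\<close> over the plane with coordinates \<open>h1\<close>, \<open>h2\<close>, and the two
hypotheses are the classical formulas for the mean and the Gauss curvature of a graph, with the
mean curvature given by the self-expander equation and twice the Gauss curvature written as
\<open>H\<^sup>2 - a\<^sup>2\<close>. At \<open>p\<close> the position vector is normal, and differentiating the equations once leaves
only terms with third derivatives of \<open>w\<close>. They form a homogeneous linear system for the four
third derivatives, which is regular if \<open>(t - r)\<^sup>2 + 4 s\<^sup>2\<close> is not zero, where \<open>r\<close>, \<open>s\<close>, \<open>t\<close> are the
values of \<open>w11\<close>, \<open>w12\<close>, \<open>w22\<close> at \<open>p\<close>: the second fundamental form is parallel at \<open>p\<close>, unless \<open>p\<close>
is umbilic. An umbilic point with nonpositive Gauss curvature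
is flat.

In the second derivatives the only unknowns are the five fourth derivatives of \<open>w\<close>. The trace of
the twice differentiated Gauss equation contains them exactly in the combinations that the
twice differentiated mean curvature equation determines. Eliminating them gives
\<open>a\<^sup>2 (1 + 2 a\<^sup>2) = 0\<close>, which is the identity of Simons for self-expanders,
\<open>|\<nabla>A|\<^sup>2 = (|A|\<^sup>2 + 1/2) |A|\<^sup>2\<close>, at a point where \<open>\<nabla>A = 0\<close>.
\<close>

lemma expander_graph_sff_norm_zero:
  fixes w :: "real^2 \<Rightarrow> real" and a :: real
  defines "w1 \<equiv> lie X1 w" and "w2 \<equiv> lie X2 w"
  defines "w11 \<equiv> lie X1 w1" and "w12 \<equiv> lie X1 w2" and "w22 \<equiv> lie X2 w2"
  assumes w: "smooth_on w S" and p: "p \<in> S"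
    and mean: "\<And>x. x \<in> S \<Longrightarrow>
      (w x - h1 x * w1 x - h2 x * w2 x) * (1 + w1 x * w1 x + w2 x * w2 x) =
      2 * ((1 + w1 x * w1 x) * w22 x - 2 * (w1 x * w2 x * w12 x) + (1 + w2 x * w2 x) * w11 x)"
    and gauss: "\<And>x. x \<in> S \<Longrightarrow> 8 * (w11 x * w22 x - w12 x * w12 x) =
      (w x - h1 x * w1 x - h2 x * w2 x) * (w x - h1 x * w1 x - h2 x * w2 x)
        * (1 + w1 x * w1 x + w2 x * w2 x)
      - 4 * a\<^sup>2 * ((1 + w1 x * w1 x + w2 x * w2 x) * (1 + w1 x * w1 x + w2 x * w2 x))"
    and crit: "h1 p = 0" "h2 p = 0" "w1 p = 0" "w2 p = 0"
    and nonpos: "w11 p * w22 p - w12 p * w12 p \<le> 0"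
  shows "a = 0"
proof -
  define c r s t where "c = w p" and "r = w11 p" and "s = w12 p" and "t = w22 p"
  have smooth: "smooth_on w1 S" "smooth_on w2 S" "smooth_on w11 S" "smooth_on w12 S" "smooth_on w22 S"
    unfolding w1_def w2_def w11_def w12_def w22_def by (intro smooth_lie frame_fields w)+
  note sm = w smooth smooth_h
  have w21: "lie X2 w1 x = w12 x" if "x \<in> S" for x
    unfolding w1_def w2_def w12_def using lie_commute[OF w that] by simp
  have w112: "lie X2 w11 x = lie X1 w12 x" if "x \<in> S" for x
    using lie_commute[OF smooth(1) that] lie_cong[OF open_S that, of "lie X2 w1" w12 X1] w21 unfolding w11_def by simp
  have w122: "lie X2 w12 x = lie X1 w22 x" if "x \<in> S" for x
    using lie_commute[OF smooth(2) that] unfolding w12_def w22_def by simp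
  define K0 K1 K2 K3 where "K0 = lie X1 w11 p" and "K1 = lie X1 w12 p"
    and "K2 = lie X1 w22 p" and "K3 = lie X2 w22 p"
  define A B C D E where "A = lie X1 (lie X1 w11) p" and "B = lie X1 (lie X1 w12) p"
    and "C = lie X1 (lie X1 w22) p" and "D = lie X1 (lie X2 w22) p" and "E = lie X2 (lie X2 w22) p"
  have first: "lie X1 w p = 0" "lie X2 w p = 0" "lie X1 w1 p = r" "lie X2 w1 p = s"
    "lie X1 w2 p = s" "lie X2 w2 p = t"
    "lie X1 h1 p = 1" "lie X1 h2 p = 0" "lie X2 h1 p = 0" "lie X2 h2 p = 1"
    "lie X1 w11 p = K0" "lie X1 w12 p = K1" "lie X1 w22 p = K2"
    "lie X2 w11 p = K1" "lie X2 w12 p = K2" "lie X2 w22 p = K3"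
    using crit w21[OF p] w112[OF p] w122[OF p] dual[OF p]
    unfolding r_def s_def t_def K0_def K1_def K2_def K3_def w11_def w12_def w22_def
    by (simp_all add: w1_def w2_def)
  have vals: "w p = c" "w11 p = r" "w12 p = s" "w22 p = t" "w1 p = 0" "w2 p = 0" "h1 p = 0" "h2 p = 0"
    using crit by (simp_all add: c_def r_def s_def t_def)
  have cong: "lie X (lie Y f) p = lie X g p" if "\<And>x. x \<in> S \<Longrightarrow> lie Y f x = g x" for X Y f g
    by (rule lie_cong[OF open_S p that])
  have second_w: "lie X1 (lie X1 w) p = r" "lie X1 (lie X2 w) p = s" "lie X2 (lie X2 w) p = t"
    using first unfolding w1_def w2_def by auto
  have second_w1: "lie X1 (lie X1 w1) p = K0" "lie X1 (lie X2 w1) p = K1" "lie X2 (lie X2 w1) p = K2"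
    using first cong[of X2 w1 w12 X1, OF w21] cong[of X2 w1 w12 X2, OF w21]
    unfolding w11_def by auto
  have second_w2: "lie X1 (lie X1 w2) p = K1" "lie X1 (lie X2 w2) p = K2" "lie X2 (lie X2 w2) p = K3"
    using first unfolding w12_def w22_def by auto
  have second_h: "lie X (lie X1 h1) p = 0" "lie X (lie X2 h1) p = 0"
    "lie X (lie X1 h2) p = 0" "lie X (lie X2 h2) p = 0" for X
    by (simp_all add: lie_lie_dual p)
  have fourth: "lie X1 (lie X1 w11) p = A" "lie X1 (lie X1 w12) p = B" "lie X1 (lie X1 w22) p = C"
    "lie X1 (lie X2 w11) p = B" "lie X1 (lie X2 w12) p = C" "lie X1 (lie X2 w22) p = D"
    "lie X2 (lie X2 w11) p = C" "lie X2 (lie X2 w12) p = D" "lie X2 (lie X2 w22) p = E"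
  proof -
    show b: "lie X1 (lie X2 w11) p = B" using cong[of X2 w11 "lie X1 w12" X1, OF w112] by (simp add: B_def)
    show cc: "lie X1 (lie X2 w12) p = C" using cong[of X2 w12 "lie X1 w22" X1, OF w122] by (simp add: C_def)
    show "lie X2 (lie X2 w11) p = C" using cong[of X2 w11 "lie X1 w12" X2, OF w112] lie_commute[OF smooth(4) p] cc by simp
    show "lie X2 (lie X2 w12) p = D" using cong[of X2 w12 "lie X1 w22" X2, OF w122] lie_commute[OF smooth(5) p]
      by (simp add: D_def)
  qed (simp_all add: A_def B_def C_def D_def E_def)
  note rules = lie_add lie_diff lie_mult lie2_add lie2_diff lie2_mult smooth_on_const
    smooth_on_add[OF open_S] smooth_on_diff[OF open_S] smooth_on_mult[OF open_S] smooth_lie open_S p sm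
  note vals' = vals first second_w second_w1 second_w2 second_h fourth
  \<comment> \<open>The two sides of both equations as functions, to which the product rules apply.\<close>
  define LM RM LG RG where
    "LM = (\<lambda>x. (w x - h1 x * w1 x - h2 x * w2 x) * (1 + w1 x * w1 x + w2 x * w2 x))"
    and "RM = (\<lambda>x. 2 * ((1 + w1 x * w1 x) * w22 x - 2 * (w1 x * w2 x * w12 x)
      + (1 + w2 x * w2 x) * w11 x))"
    and "LG = (\<lambda>x. 8 * (w11 x * w22 x - w12 x * w12 x))"
    and "RG = (\<lambda>x. (w x - h1 x * w1 x - h2 x * w2 x)
        * (w x - h1 x * w1 x - h2 x * w2 x) * (1 + w1 x * w1 x + w2 x * w2 x)
      - 4 * a\<^sup>2 * ((1 + w1 x * w1 x + w2 x * w2 x) * (1 + w1 x * w1 x + w2 x * w2 x)))"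
  have M: "LM x = RM x" if "x \<in> S" for x
    using mean[OF that] unfolding LM_def RM_def by simp
  have G: "LG x = RG x" if "x \<in> S" for x
    using gauss[OF that] unfolding LG_def RG_def by simp
  have lie2_cong: "lie X (lie Y f) p = lie X (lie Y g) p" if "\<And>x. x \<in> S \<Longrightarrow> f x = g x" for X Y f g
  proof (rule lie_cong[OF open_S p])
    show "lie Y f x = lie Y g x" if "x \<in> S" for x
      by (rule lie_cong[OF open_S that]) fact
  qed
  note M1 = lie_cong[OF open_S p, of LM RM, OF M] and M2 = lie2_cong[of LM RM, OF M]
  note G1 = lie_cong[OF open_S p, of LG RG, OF G] and G2 = lie2_cong[of LG RG, OF G]
  note defs = LM_def RM_def LG_def RG_def
  have m0: "c = 2 * (r + t)" using mean[OF p] by (simp add: vals)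
  have g0: "8 * (r * t - s * s) = c * c - 4 * a\<^sup>2" using gauss[OF p] by (simp add: vals)
  have m1: "K0 + K2 = 0" using M1[of X1] unfolding defs by (simp add: rules vals')
  have m2: "K1 + K3 = 0" using M1[of X2] unfolding defs by (simp add: rules vals')
  have g1: "8 * (r * K2) + 8 * (K0 * t) = 16 * (K1 * s)"
    using G1[of X1] unfolding defs by (simp add: rules vals')
  have g2: "8 * (r * K3) + 8 * (K1 * t) = 16 * (K2 * s)"
    using G1[of X2] unfolding defs by (simp add: rules vals')
  show "a = 0"
  proof (cases "r = t \<and> s = 0")
    case True
    then have "r * r \<le> 0" using nonpos vals by simp
    then have "r = 0" by (auto simp: mult_le_0_iff)
    then show ?thesis using True m0 g0 by simp
  next
    case False
    have K: "K0 = 0" "K1 = 0"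
    proof -
      have e: "(t - r) * K0 - 2 * s * K1 = 0" "(t - r) * K1 + 2 * s * K0 = 0"
        using g1 g2 m1 m2 by algebra+
      have "((t - r)\<^sup>2 + (2 * s)\<^sup>2) * K0 = 0" "((t - r)\<^sup>2 + (2 * s)\<^sup>2) * K1 = 0" using e by algebra+
      moreover have "(t - r)\<^sup>2 + (2 * s)\<^sup>2 \<noteq> 0" using False by (simp only: sum_power2_eq_zero_iff) auto
      ultimately show "K0 = 0" "K1 = 0" by auto
    qed
    then have K': "K2 = 0" "K3 = 0" using m1 m2 by auto
    \<comment> \<open>The sum of \<open>g11\<close> and \<open>g22\<close> below contains only \<open>A + C\<close>, \<open>B + D\<close> and \<open>C + E\<close>, which the other three equations give.\<close>
    have m11: "- r + 2 * c * (r * r + s * s) =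
        2 * (A + C + 2 * (r * r) * t - 4 * (r * s * s) + 2 * (s * s) * r)"
      using M2[of X1 X1] unfolding defs by (simp add: rules vals' K K' algebra_simps)
    have m22: "- t + 2 * c * (s * s + t * t) =
        2 * (C + E + 2 * (s * s) * t - 4 * (s * s * t) + 2 * (t * t) * r)"
      using M2[of X2 X2] unfolding defs by (simp add: rules vals' K K' algebra_simps)
    have m12: "- s + 2 * c * (r * s + s * t) =
        2 * (B + D + 2 * (r * s * t) - 2 * (r * t + s * s) * s + 2 * (s * t * r))"
      using M2[of X1 X2] unfolding defs by (simp add: rules vals' K K' algebra_simps)
    have g11: "8 * (A * t + r * C - 2 * s * B) =
        - 2 * c * r + (2 * c * c - 16 * a\<^sup>2) * (r * r + s * s)"
      using G2[of X1 X1] unfolding defs by (simp add: rules vals' K K' algebra_simps)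
    have g22: "8 * (C * t + r * E - 2 * s * D) =
        - 2 * c * t + (2 * c * c - 16 * a\<^sup>2) * (s * s + t * t)"
      using G2[of X2 X2] unfolding defs by (simp add: rules vals' K K' algebra_simps)
    have "a\<^sup>2 * (1 + 2 * a\<^sup>2) = 0"
      using m0 g0 m11 m12 m22 g11 g22 by algebra
    moreover have "1 + 2 * a\<^sup>2 > 0" by (simp add: add_pos_nonneg)
    ultimately show ?thesis by simp
  qed
qed

end

section \<open>Curvature of a parametrised surface in coordinates\<close>

lemma orthonormal_inner_expand:
  fixes b1 b2 b3 :: "real^3"
  assumes "b1 \<bullet> b1 = 1" "b2 \<bullet> b2 = 1" "b3 \<bullet> b3 = 1" "b1 \<bullet> b2 = 0" "b1 \<bullet> b3 = 0" "b2 \<bullet> b3 = 0"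
  shows "v \<bullet> w = (v \<bullet> b1) * (w \<bullet> b1) + (v \<bullet> b2) * (w \<bullet> b2) + (v \<bullet> b3) * (w \<bullet> b3)"
proof -
  let ?B = "{b1, b2, b3}"
  have ne: "b1 \<noteq> b2" "b1 \<noteq> b3" "b2 \<noteq> b3" using assms by auto
  have orth: "pairwise orthogonal ?B"
    using assms by (auto simp: pairwise_def orthogonal_def inner_commute)
  have "independent ?B"
    using assms by (intro pairwise_orthogonal_independent[OF orth]) auto
  moreover have "card ?B = 3" using ne by simp
  ultimately have "UNIV \<subseteq> span ?B"
    by (intro card_ge_dim_independent) auto
  then have "v \<in> span ?B" by blast
  moreover have "norm i = 1" if "i \<in> ?B" for i using that assms by (auto simp: norm_eq_1)
  ultimately have "(\<Sum>i\<in>?B. (v \<bullet> i) *\<^sub>R i) = v"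
    using orthonormal_basis_expand[OF orth] by blast
  then have "v = (v \<bullet> b1) *\<^sub>R b1 + (v \<bullet> b2) *\<^sub>R b2 + (v \<bullet> b3) *\<^sub>R b3"
    using ne by (simp add: add.assoc)
  then have "v \<bullet> w = ((v \<bullet> b1) *\<^sub>R b1 + (v \<bullet> b2) *\<^sub>R b2 + (v \<bullet> b3) *\<^sub>R b3) \<bullet> w" by simp
  then show ?thesis
    by (simp only: inner_add_left inner_scaleR_left inner_commute[of w])
qed

lemma matrix_inv_2:
  fixes A :: "real^2^2"
  assumes d: "A$1$1 * A$2$2 - A$1$2 * A$2$1 = d" "d \<noteq> 0"
  shows "matrix_inv A $ 1 $ 1 = A$2$2 / d" "matrix_inv A $ 1 $ 2 = - A$1$2 / d"
    "matrix_inv A $ 2 $ 1 = - A$2$1 / d" "matrix_inv A $ 2 $ 2 = A$1$1 / d"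
proof -
  define B :: "real^2^2" where "B = (\<chi> i j. if i = 1 then (if j = 1 then A$2$2 / d else - A$1$2 / d)
    else (if j = 1 then - A$2$1 / d else A$1$1 / d))"
  have B: "A ** B = mat 1" "B ** A = mat 1"
    using d by (auto simp: vec_eq_iff matrix_matrix_mult_def sum_2 forall_2 mat_def B_def field_simps)
  then have "A ** matrix_inv A = mat 1 \<and> matrix_inv A ** A = mat 1"
    unfolding matrix_inv_def by (rule someI[of _ B, OF conjI])
  then have "matrix_inv A = B"
    using B by (metis matrix_mul_assoc matrix_mul_lid matrix_mul_rid)
  then show "matrix_inv A $ 1 $ 1 = A$2$2 / d" "matrix_inv A $ 1 $ 2 = - A$1$2 / d"
    "matrix_inv A $ 2 $ 1 = - A$2$1 / d" "matrix_inv A $ 2 $ 2 = A$1$1 / d"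
    by (simp_all add: B_def)
qed

definition second_deriv :: "(real^2 \<Rightarrow> real^3) \<Rightarrow> real^2 \<Rightarrow> 2 \<Rightarrow> 2 \<Rightarrow> real^3" where
  "second_deriv f u i j = frechet_derivative (\<lambda>v. frechet_derivative f (at v) (axis j 1)) (at u) (axis i 1)"

lemma sff_coord_eq: "sff_coord f u i j = (second_deriv f u i j \<bullet> unit_normal f u) *\<^sub>R unit_normal f u"
  by (simp add: sff_coord_def second_fundamental_form_def normal_part_def second_deriv_def)

lemma unit_normal_facts:
  assumes "f differentiable (at u)" "inj (frechet_derivative f (at u))"
  shows "cross3 (coord_tangent f u 1) (coord_tangent f u 2) \<noteq> 0"
    and "unit_normal f u \<bullet> unit_normal f u = 1"
    and "coord_tangent f u i \<bullet> unit_normal f u = 0"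
proof -
  let ?D = "frechet_derivative f (at u)" and ?T = "coord_tangent f u"
  note lin = linear_frechet_derivative[OF assms(1)]
  show c: "cross3 (?T 1) (?T 2) \<noteq> 0"
  proof
    assume "cross3 (?T 1) (?T 2) = 0"
    then have "collinear {0, ?T 1, ?T 2}" by (simp add: cross_eq_0)
    then consider "?T 1 = 0" | "?T 2 = 0" | k where "?T 2 = k *\<^sub>R ?T 1"
      by (auto simp: collinear_lemma)
    then obtain v where "v \<noteq> 0" "?D v = 0"
    proof cases
      case 1
      then show ?thesis using that[of "axis 1 1"] by (simp add: coord_tangent_def)
    next
      case 2
      then show ?thesis using that[of "axis 2 1"] by (simp add: coord_tangent_def)
    next
      case 3
      have "?D (axis 2 1 - k *\<^sub>R axis 1 1) = 0"
        using 3 by (simp add: coord_tangent_def linear_diff[OF lin] linear_cmul[OF lin])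
      moreover have "axis 2 1 - k *\<^sub>R axis 1 1 \<noteq> (0::real^2)"
      proof
        assume "axis 2 1 - k *\<^sub>R axis 1 1 = (0::real^2)"
        then have "(axis 2 1 - k *\<^sub>R axis 1 1 :: real^2) $ 2 = 0" by simp
        then show False by (simp add: axis_def)
      qed
      ultimately show ?thesis using that by blast
    qed
    then show False using assms(2) linear_0[OF lin] by (metis injD)
  qed
  show "unit_normal f u \<bullet> unit_normal f u = 1"
    using c by (simp add: unit_normal_def sgn_div_norm dot_square_norm power2_eq_square)
  show "?T i \<bullet> unit_normal f u = 0"
    using exhaust_2[of i] by (auto simp: unit_normal_def sgn_div_norm dot_cross_self)
qed

text \<open>
These are \<open>H = tr S\<close> and \<open>|A|\<^sup>2 = (tr S)\<^sup>2 - 2 det S\<close> for the shape operator \<open>S\<close>, with denominators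
cleared. The norm is defined as a square root, so its radicand must be shown to be nonnegative; in
a Gram-Schmidt frame of the tangent plane it is a sum of squares, which also shows that the second
fundamental form vanishes with its norm.
\<close>

lemma curvature_coords:
  fixes f :: "real^2 \<Rightarrow> real^3"
  assumes "f differentiable (at u)" "inj (frechet_derivative f (at u))"
    and sym: "second_deriv f u 1 2 = second_deriv f u 2 1"
  defines "E \<equiv> coord_tangent f u 1 \<bullet> coord_tangent f u 1"
    and "F \<equiv> coord_tangent f u 1 \<bullet> coord_tangent f u 2"
    and "G \<equiv> coord_tangent f u 2 \<bullet> coord_tangent f u 2"
    and "L \<equiv> second_deriv f u 1 1 \<bullet> unit_normal f u"
    and "M \<equiv> second_deriv f u 1 2 \<bullet> unit_normal f u"
    and "N \<equiv> second_deriv f u 2 2 \<bullet> unit_normal f u"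
  defines "d \<equiv> E * G - F * F"
  shows "d > 0"
    and "(mean_curvature_vector f u \<bullet> unit_normal f u) * d = E * N - 2 * F * M + G * L"
    and "(sff_norm f u)\<^sup>2 * d\<^sup>2 = (E * N - 2 * F * M + G * L)\<^sup>2 - 2 * d * (L * N - M\<^sup>2)"
    and "sff_norm f u = 0 \<Longrightarrow> L = 0 \<and> M = 0 \<and> N = 0"
proof -
  note n = unit_normal_facts[OF assms(1,2)]
  let ?T = "coord_tangent f u"
  have "norm (cross3 (?T 1) (?T 2)) ^ 2 = d"
    using norm_cross_dot[of "?T 1" "?T 2"]
    unfolding d_def E_def F_def G_def power_mult_distrib power2_norm_eq_inner
    by (simp add: power2_eq_square)
  then show d: "d > 0" using n(1) by (metis zero_less_norm_iff zero_less_power)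
  have "?T 1 \<noteq> 0" using n(1) by auto
  then have E: "E > 0" by (simp add: E_def)
  have det: "induced_metric f u $1$1 * induced_metric f u $2$2 - induced_metric f u $1$2 * induced_metric f u $2$1 = d"
    by (simp add: induced_metric_def d_def E_def F_def G_def inner_commute)
  note inv = matrix_inv_2[OF det d[THEN less_imp_neq, symmetric]]
  have g: "inverse_metric f u $1$1 = G / d" "inverse_metric f u $1$2 = - F / d"
    "inverse_metric f u $2$1 = - F / d" "inverse_metric f u $2$2 = E / d"
    unfolding inv by (simp_all add: induced_metric_def E_def F_def G_def inner_commute)
  note h = sff_coord_eq[of f u 1 1, folded L_def] sff_coord_eq[of f u 1 2, folded M_def]
    sff_coord_eq[of f u 2 1, folded sym, folded M_def] sff_coord_eq[of f u 2 2, folded N_def]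
  show "(mean_curvature_vector f u \<bullet> unit_normal f u) * d = E * N - 2 * F * M + G * L"
    unfolding mean_curvature_vector_def sum_2 g h inner_add_left inner_scaleR_left n(2)
    using d by (simp add: field_simps)
  define Q where "Q = (\<Sum>i\<in>UNIV. \<Sum>j\<in>UNIV. \<Sum>k\<in>UNIV. \<Sum>l\<in>UNIV.
       inverse_metric f u $ i $ k * inverse_metric f u $ j $ l *
       (sff_coord f u i j \<bullet> sff_coord f u k l))"
  have "Q * d\<^sup>2 = (Q * d) * d" by (simp add: power2_eq_square)
  have Q: "Q * d\<^sup>2 = G*G*L*L - 4*F*G*L*M + 2*F*F*L*N + 2*E*G*M*M + 2*F*F*M*M - 4*E*F*M*N + E*E*N*N"
    unfolding Q_def sum_2 g h using d n(2)
    by (simp add: power2_eq_square) (simp add: field_simps)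
  have Q2: "Q * d\<^sup>2 = (E * N - 2 * F * M + G * L)\<^sup>2 - 2 * d * (L * N - M\<^sup>2)"
    unfolding Q unfolding d_def by (simp add: power2_eq_square algebra_simps)
  \<comment> \<open>The sum of squares in the orthonormal frame obtained from the coordinate tangents.\<close>
  have Q3: "Q * d\<^sup>2 * E\<^sup>2 = (d * L)\<^sup>2 + 2 * d * (E * M - F * L)\<^sup>2 + (E * E * N - 2 * E * F * M + F * F * L)\<^sup>2"
    unfolding Q unfolding d_def by (simp add: power2_eq_square algebra_simps)
  have "Q * d\<^sup>2 * E\<^sup>2 \<ge> 0" unfolding Q3 using d by simp
  then have Q0: "Q \<ge> 0" using d E by (simp add: zero_le_mult_iff)
  have norm: "sff_norm f u = sqrt Q" by (simp add: sff_norm_def Q_def)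
  show "(sff_norm f u)\<^sup>2 * d\<^sup>2 = (E * N - 2 * F * M + G * L)\<^sup>2 - 2 * d * (L * N - M\<^sup>2)"
    using Q0 Q2 by (simp add: norm)
  show "L = 0 \<and> M = 0 \<and> N = 0" if "sff_norm f u = 0"
  proof -
    have "Q = 0" using that by (simp add: norm)
    then have s: "(d * L)\<^sup>2 + 2 * d * (E * M - F * L)\<^sup>2 + (E * E * N - 2 * E * F * M + F * F * L)\<^sup>2 = 0"
      using Q3 by simp
    have p: "(d * L)\<^sup>2 \<ge> 0" "2 * d * (E * M - F * L)\<^sup>2 \<ge> 0"
      "(E * E * N - 2 * E * F * M + F * F * L)\<^sup>2 \<ge> 0" using d by simp_all
    have "(d * L)\<^sup>2 = 0" "2 * d * (E * M - F * L)\<^sup>2 = 0" "(E * E * N - 2 * E * F * M + F * F * L)\<^sup>2 = 0"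
      using s p by linarith+
    then have L: "L = 0" and "E * M - F * L = 0" "E * E * N - 2 * E * F * M + F * F * L = 0"
      using d by simp_all
    then have M: "M = 0" using E by simp
    then have "E * E * N = 0" using L \<open>E * E * N - 2 * E * F * M + F * F * L = 0\<close> by simp
    then show ?thesis using L M E by simp
  qed
qed

lemma second_deriv_inner:
  assumes f: "smooth_on f S" and S: "open S" "u \<in> S"
  shows "second_deriv f u i j \<bullet> b =
    frechet_derivative (\<lambda>v. frechet_derivative (\<lambda>x. f x \<bullet> b) (at v) (axis j 1)) (at u) (axis i 1)"
proof -
  have "frechet_derivative (\<lambda>x. f x \<bullet> b) (at v) (axis j 1) = frechet_derivative f (at v) (axis j 1) \<bullet> b"
    if "v \<in> S" for v
    by (rule frechet_derivative_linear[OF bounded_linear_inner_left smooth_on_differentiable[OF f S(1) that]])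
  from frechet_derivative_cong_open[OF S this]
  have "frechet_derivative (\<lambda>v. frechet_derivative (\<lambda>x. f x \<bullet> b) (at v) (axis j 1)) (at u) (axis i 1) =
      frechet_derivative (\<lambda>v. frechet_derivative f (at v) (axis j 1) \<bullet> b) (at u) (axis i 1)"
    by (rule fun_cong)
  also have "\<dots> = second_deriv f u i j \<bullet> b"
    unfolding second_deriv_def
    by (rule frechet_derivative_linear[OF bounded_linear_inner_left
          smooth_on_differentiable[OF smooth_on_frechet_derivative[OF f] S]])
  finally show ?thesis by simp
qed

lemma smooth_on_inner: "open S \<Longrightarrow> smooth_on f S \<Longrightarrow> smooth_on (\<lambda>x. f x \<bullet> b) S"
  by (rule smooth_on_linear[OF _ bounded_linear_inner_left])

lemma second_deriv_commute:
  assumes f: "smooth_on f S" and S: "open S" "u \<in> S"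
  shows "second_deriv f u i j = second_deriv f u j i"
proof (rule vector_eq_rdot[THEN iffD1], rule allI)
  show "second_deriv f u i j \<bullet> b = second_deriv f u j i \<bullet> b" for b
    unfolding second_deriv_inner[OF assms]
    by (rule frechet_derivative_commute[OF S smooth_on_inner[OF S(1) f]])
qed

section \<open>Surfaces as graphs over a tangent plane\<close>

lemma (in dual_fields) lie_lie_coords:
  assumes m: "smooth_on m S" and Y: "frame_field Y" and x: "x \<in> S"
    and zero: "lie (\<lambda>_. axis 1 1) m x = 0" "lie (\<lambda>_. axis 2 1) m x = 0"
  shows "lie X (lie Y m) x =
    X x $ 1 * Y x $ 1 * lie (\<lambda>_. axis 1 1) (lie (\<lambda>_. axis 1 1) m) x
    + X x $ 2 * Y x $ 1 * lie (\<lambda>_. axis 2 1) (lie (\<lambda>_. axis 1 1) m) x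
    + X x $ 1 * Y x $ 2 * lie (\<lambda>_. axis 1 1) (lie (\<lambda>_. axis 2 1) m) x
    + X x $ 2 * Y x $ 2 * lie (\<lambda>_. axis 2 1) (lie (\<lambda>_. axis 2 1) m) x"
proof -
  have "lie X (lie Y m) x = Y x $ 1 * lie X (lie (\<lambda>_. axis 1 1) m) x + Y x $ 2 * lie X (lie (\<lambda>_. axis 2 1) m) x"
    using lie_lie_expand[OF m Y x, of X] zero by simp
  then show ?thesis
    unfolding lie_coords[OF smooth_lie_const[OF m] x, of X] by (simp add: algebra_simps)
qed

text \<open>
Over the plane spanned by \<open>b1\<close> and \<open>b2\<close> the surface is the graph of the height function \<open>f \<bullet> b3\<close>.
The fields \<open>X1\<close>, \<open>X2\<close> are the coordinate fields of the orthogonal projection to that plane, so that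
\<open>df (X1) = b1 + (X1 w) b3\<close> and similarly for \<open>X2\<close>.
\<close>

locale adapted_graph = dual_fields S X1 X2 "\<lambda>x. f x \<bullet> b1" "\<lambda>x. f x \<bullet> b2"
  for S X1 X2 and f :: "real^2 \<Rightarrow> real^3" and b1 b2 b3 :: "real^3" +
  assumes smooth_f: "smooth_on f S"
    and inj_f: "\<And>x. x \<in> S \<Longrightarrow> inj (frechet_derivative f (at x))"
    and orthonormal: "b1 \<bullet> b1 = 1" "b2 \<bullet> b2 = 1" "b3 \<bullet> b3 = 1"
      "b1 \<bullet> b2 = 0" "b1 \<bullet> b3 = 0" "b2 \<bullet> b3 = 0"
begin

definition w :: "real^2 \<Rightarrow> real" where "w x = f x \<bullet> b3"

lemma smooth_inner: "smooth_on (\<lambda>x. f x \<bullet> v) S"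
  by (rule smooth_on_inner[OF open_S smooth_f])

lemma smooth_w: "smooth_on w S"
  unfolding w_def[abs_def] by (rule smooth_inner)

lemmas inner_expand = orthonormal_inner_expand[OF orthonormal]

lemma diff_f: "x \<in> S \<Longrightarrow> f differentiable (at x)"
  by (rule smooth_on_differentiable[OF smooth_f open_S])

lemma lie_inner: "x \<in> S \<Longrightarrow> lie X (\<lambda>x. f x \<bullet> v) x = frechet_derivative f (at x) (X x) \<bullet> v"
  unfolding lie_def by (rule frechet_derivative_linear[OF bounded_linear_inner_left diff_f])

lemma graph_tangent:
  assumes x: "x \<in> S" and b3: "b3 = unit_normal f x"
  shows "lie X w x = 0"
  using unit_normal_facts(3)[OF diff_f[OF x] inj_f[OF x]]
  unfolding w_def[abs_def] unfolding lie_inner[OF x] frechet_derivative_coords[OF diff_f[OF x], of "X x"]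
    inner_add_left inner_scaleR_left b3 by (simp add: coord_tangent_def)

lemma graph_normal:
  assumes x: "x \<in> S"
  defines "n \<equiv> unit_normal f x" and "w1 \<equiv> lie X1 w x" and "w2 \<equiv> lie X2 w x"
  shows "n \<bullet> b1 = - w1 * (n \<bullet> b3)" "n \<bullet> b2 = - w2 * (n \<bullet> b3)"
    and "(n \<bullet> b3)\<^sup>2 * (1 + w1 * w1 + w2 * w2) = 1"
proof -
  let ?D = "frechet_derivative f (at x)"
  have D: "?D v \<bullet> n = 0" for v
    unfolding frechet_derivative_coords[OF diff_f[OF x], of v] n_def inner_add_left inner_scaleR_left
    using unit_normal_facts(3)[OF diff_f[OF x] inj_f[OF x]] by (simp add: coord_tangent_def)
  have c: "?D (X1 x) \<bullet> b1 = 1" "?D (X1 x) \<bullet> b2 = 0" "?D (X2 x) \<bullet> b1 = 0" "?D (X2 x) \<bullet> b2 = 1"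
    "?D (X1 x) \<bullet> b3 = w1" "?D (X2 x) \<bullet> b3 = w2"
    using dual[OF x] lie_inner[OF x] unfolding w1_def w2_def w_def[abs_def] by simp_all
  show n1: "n \<bullet> b1 = - w1 * (n \<bullet> b3)"
    using D[of "X1 x"] unfolding inner_expand[of "?D (X1 x)" n] c by simp
  show n2: "n \<bullet> b2 = - w2 * (n \<bullet> b3)"
    using D[of "X2 x"] unfolding inner_expand[of "?D (X2 x)" n] c by simp
  have "n \<bullet> n = 1" unfolding n_def by (rule unit_normal_facts(2)[OF diff_f[OF x] inj_f[OF x]])
  then show "(n \<bullet> b3)\<^sup>2 * (1 + w1 * w1 + w2 * w2) = 1"
    unfolding inner_expand[of n n] n1 n2 by (simp add: power2_eq_square algebra_simps)
qed

text \<open>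
For the normal \<open>n\<close> at the single point \<open>x\<close>, held constant, the function \<open>m = f \<bullet> n\<close> is critical at \<open>x\<close>. Its
Hessian there is therefore independent of coordinates, and it is the second fundamental form. In the
coordinates of the projection it is a multiple of the Hessian of \<open>w\<close>, because \<open>m\<close> differs from that
multiple of \<open>w\<close> by a linear function of the two coordinates.
\<close>

lemma graph_second_form:
  assumes x: "x \<in> S" and XY: "frame_field X" "frame_field Y"
  defines "n \<equiv> unit_normal f x"
  shows "(n \<bullet> b3) * lie X (lie Y w) x =
    X x $ 1 * Y x $ 1 * (second_deriv f x 1 1 \<bullet> n) + X x $ 2 * Y x $ 1 * (second_deriv f x 1 2 \<bullet> n)
    + X x $ 1 * Y x $ 2 * (second_deriv f x 1 2 \<bullet> n) + X x $ 2 * Y x $ 2 * (second_deriv f x 2 2 \<bullet> n)"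
proof -
  define m where "m = (\<lambda>y. f y \<bullet> n)"
  have m: "smooth_on m S" unfolding m_def by (rule smooth_inner)
  have zero: "lie (\<lambda>_. axis i 1) m x = 0" for i
    unfolding m_def lie_inner[OF x] n_def
    using unit_normal_facts(3)[OF diff_f[OF x] inj_f[OF x], of i] by (simp add: coord_tangent_def)
  have h: "lie (\<lambda>_. axis i 1) (lie (\<lambda>_. axis j 1) m) x = second_deriv f x i j \<bullet> n" for i j
    unfolding second_deriv_inner[OF smooth_f open_S x] m_def lie_def[abs_def] ..
  have sym: "second_deriv f x 2 1 = second_deriv f x 1 2"
    by (rule second_deriv_commute[OF smooth_f open_S x])
  have eq: "m = (\<lambda>y. (f y \<bullet> b1) * (n \<bullet> b1) + (f y \<bullet> b2) * (n \<bullet> b2) + (n \<bullet> b3) * w y)"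
    unfolding m_def w_def using inner_expand[of _ n] by (simp add: fun_eq_iff mult.commute)
  have h0: "lie X (lie Y (\<lambda>y. f y \<bullet> b1)) x = 0" "lie X (lie Y (\<lambda>y. f y \<bullet> b2)) x = 0"
    using lie_lie_dual[OF XY(2) x, of X] by simp_all
  have "lie X (lie Y m) x = (n \<bullet> b3) * lie X (lie Y w) x"
    unfolding eq using smooth_inner smooth_w x XY open_S h0
    by (simp add: lie2_add lie2_mult smooth_on_add smooth_on_mult smooth_on_const)
  then show ?thesis
    using lie_lie_coords[OF m XY(2) x zero zero, of X] unfolding h sym by simp
qed

context
  fixes x assumes x: "x \<in> S"
begin

lemma graph_first_form:
  defines "E \<equiv> coord_tangent f x 1 \<bullet> coord_tangent f x 1"
    and "F \<equiv> coord_tangent f x 1 \<bullet> coord_tangent f x 2"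
    and "G \<equiv> coord_tangent f x 2 \<bullet> coord_tangent f x 2"
  shows "1 + lie X1 w x * lie X1 w x = X1 x $ 1 * X1 x $ 1 * E + 2 * (X1 x $ 1 * X1 x $ 2) * F + X1 x $ 2 * X1 x $ 2 * G"
    and "lie X1 w x * lie X2 w x = X1 x $ 1 * X2 x $ 1 * E + (X1 x $ 1 * X2 x $ 2 + X1 x $ 2 * X2 x $ 1) * F + X1 x $ 2 * X2 x $ 2 * G"
    and "1 + lie X2 w x * lie X2 w x = X2 x $ 1 * X2 x $ 1 * E + 2 * (X2 x $ 1 * X2 x $ 2) * F + X2 x $ 2 * X2 x $ 2 * G"
proof -
  let ?D = "frechet_derivative f (at x)"
  have c: "?D (X1 x) \<bullet> b1 = 1" "?D (X1 x) \<bullet> b2 = 0" "?D (X2 x) \<bullet> b1 = 0" "?D (X2 x) \<bullet> b2 = 1"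
    "?D (X1 x) \<bullet> b3 = lie X1 w x" "?D (X2 x) \<bullet> b3 = lie X2 w x"
    using dual[OF x] lie_inner[OF x] unfolding w_def[abs_def] by simp_all
  have e: "?D v \<bullet> ?D v' = v$1 * v'$1 * E + (v$1 * v'$2 + v$2 * v'$1) * F + v$2 * v'$2 * G" for v v'
    unfolding frechet_derivative_coords[OF diff_f[OF x], of v] frechet_derivative_coords[OF diff_f[OF x], of v']
      inner_add_left inner_add_right inner_scaleR_left inner_scaleR_right E_def F_def G_def coord_tangent_def
    by (simp add: inner_commute algebra_simps)
  show "1 + lie X1 w x * lie X1 w x = X1 x $ 1 * X1 x $ 1 * E + 2 * (X1 x $ 1 * X1 x $ 2) * F + X1 x $ 2 * X1 x $ 2 * G"
    using e[of "X1 x" "X1 x"] unfolding inner_expand[of "?D (X1 x)" "?D (X1 x)"] c by (simp add: algebra_simps)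
  show "lie X1 w x * lie X2 w x = X1 x $ 1 * X2 x $ 1 * E + (X1 x $ 1 * X2 x $ 2 + X1 x $ 2 * X2 x $ 1) * F + X1 x $ 2 * X2 x $ 2 * G"
    using e[of "X1 x" "X2 x"] unfolding inner_expand[of "?D (X1 x)" "?D (X2 x)"] c by (simp add: algebra_simps)
  show "1 + lie X2 w x * lie X2 w x = X2 x $ 1 * X2 x $ 1 * E + 2 * (X2 x $ 1 * X2 x $ 2) * F + X2 x $ 2 * X2 x $ 2 * G"
    using e[of "X2 x" "X2 x"] unfolding inner_expand[of "?D (X2 x)" "?D (X2 x)"] c by (simp add: algebra_simps)
qed

text \<open>
Passing from the parameter directions to \<open>X1\<close>, \<open>X2\<close> multiplies each of the expressions \<open>E N - 2 F M + G L\<close>,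
\<open>E G - F\<^sup>2\<close> and \<open>L N - M\<^sup>2\<close> by the square of the determinant \<open>D\<close> of the change of basis, so \<open>curvature_coords\<close>
carries over to the graph.
\<close>

lemma graph_curvature_equations:
  defines "w1 \<equiv> lie X1 w x" and "w2 \<equiv> lie X2 w x"
    and "w11 \<equiv> lie X1 (lie X1 w) x" and "w12 \<equiv> lie X1 (lie X2 w) x" and "w22 \<equiv> lie X2 (lie X2 w) x"
    and "q \<equiv> 1 + lie X1 w x * lie X1 w x + lie X2 w x * lie X2 w x"
    and "n \<equiv> unit_normal f x"
  shows "(mean_curvature_vector f x \<bullet> n) * q =
      (n \<bullet> b3) * ((1 + w1 * w1) * w22 - 2 * (w1 * w2 * w12) + (1 + w2 * w2) * w11)"
    and "(sff_norm f x)\<^sup>2 * q = (mean_curvature_vector f x \<bullet> n)\<^sup>2 * q - 2 * (n \<bullet> b3)\<^sup>2 * (w11 * w22 - w12 * w12)"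
proof -
  define E F G L M N where "E = coord_tangent f x 1 \<bullet> coord_tangent f x 1"
    and "F = coord_tangent f x 1 \<bullet> coord_tangent f x 2"
    and "G = coord_tangent f x 2 \<bullet> coord_tangent f x 2"
    and "L = second_deriv f x 1 1 \<bullet> n" and "M = second_deriv f x 1 2 \<bullet> n" and "N = second_deriv f x 2 2 \<bullet> n"
  define d where "d = E * G - F * F"
  define \<beta> where "\<beta> = n \<bullet> b3"
  define \<phi> a where "\<phi> = mean_curvature_vector f x \<bullet> n" and "a = (sff_norm f x)\<^sup>2"
  note defs = E_def F_def G_def L_def M_def N_def n_def
  note c = curvature_coords[OF diff_f[OF x] inj_f[OF x] second_deriv_commute[OF smooth_f open_S x],
      folded n_def, folded defs, folded d_def, folded \<phi>_def a_def]
  obtain x1 x2 y1 y2 where xy: "x1 = X1 x $ 1" "x2 = X1 x $ 2" "y1 = X2 x $ 1" "y2 = X2 x $ 2" by blast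
  note e = graph_first_form[folded E_def F_def G_def, folded w1_def w2_def, folded xy]
  have s: "\<beta> * w11 = x1 * x1 * L + x2 * x1 * M + x1 * x2 * M + x2 * x2 * N"
    "\<beta> * w12 = x1 * y1 * L + x2 * y1 * M + x1 * y2 * M + x2 * y2 * N"
    "\<beta> * w22 = y1 * y1 * L + y2 * y1 * M + y1 * y2 * M + y2 * y2 * N"
    using graph_second_form[OF x, of X1 X1] graph_second_form[OF x, of X1 X2] graph_second_form[OF x, of X2 X2]
    unfolding L_def M_def N_def \<beta>_def w11_def w12_def w22_def xy n_def by simp_all
  define D where "D = x1 * y2 - x2 * y1"
  have q: "q = 1 + w1 * w1 + w2 * w2" by (simp add: q_def w1_def w2_def)
  have qd: "q = D\<^sup>2 * d"
  proof -
    have "q = (1 + w1 * w1) * (1 + w2 * w2) - (w1 * w2) * (w1 * w2)" by (simp add: q algebra_simps)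
    also have "\<dots> = D\<^sup>2 * d" unfolding e unfolding D_def d_def by (simp add: power2_eq_square algebra_simps)
    finally show ?thesis .
  qed
  have "\<beta> * ((1 + w1 * w1) * w22 - 2 * (w1 * w2 * w12) + (1 + w2 * w2) * w11) =
      (1 + w1 * w1) * (\<beta> * w22) - 2 * (w1 * w2) * (\<beta> * w12) + (1 + w2 * w2) * (\<beta> * w11)"
    by (simp add: algebra_simps)
  also have "\<dots> = D\<^sup>2 * (E * N - 2 * F * M + G * L)"
    unfolding s e unfolding D_def by (simp add: power2_eq_square algebra_simps)
  also have "\<dots> = \<phi> * q" unfolding c(2)[symmetric] qd by simp
  finally show "(mean_curvature_vector f x \<bullet> n) * q =
      (n \<bullet> b3) * ((1 + w1 * w1) * w22 - 2 * (w1 * w2 * w12) + (1 + w2 * w2) * w11)"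
    by (simp add: \<phi>_def \<beta>_def)
  have K: "\<beta>\<^sup>2 * (w11 * w22 - w12 * w12) = D\<^sup>2 * (L * N - M\<^sup>2)"
  proof -
    have "\<beta>\<^sup>2 * (w11 * w22 - w12 * w12) = (\<beta> * w11) * (\<beta> * w22) - (\<beta> * w12) * (\<beta> * w12)"
      by (simp add: power2_eq_square algebra_simps)
    also have "\<dots> = D\<^sup>2 * (L * N - M\<^sup>2)"
      unfolding s unfolding D_def by (simp add: power2_eq_square algebra_simps)
    finally show ?thesis .
  qed
  have "a * d\<^sup>2 = (\<phi> * d)\<^sup>2 - 2 * d * (L * N - M\<^sup>2)" using c(2,3) by simp
  then have "(a * d) * d = (\<phi>\<^sup>2 * d - 2 * (L * N - M\<^sup>2)) * d" by (simp add: power2_eq_square algebra_simps)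
  then have "a * d = \<phi>\<^sup>2 * d - 2 * (L * N - M\<^sup>2)" using c(1) by simp
  then have "D\<^sup>2 * (a * d) = D\<^sup>2 * (\<phi>\<^sup>2 * d - 2 * (L * N - M\<^sup>2))" by simp
  then have "a * q = \<phi>\<^sup>2 * q - 2 * (\<beta>\<^sup>2 * (w11 * w22 - w12 * w12))"
    unfolding K qd by (simp add: algebra_simps)
  then show "(sff_norm f x)\<^sup>2 * q = (mean_curvature_vector f x \<bullet> n)\<^sup>2 * q - 2 * (n \<bullet> b3)\<^sup>2 * (w11 * w22 - w12 * w12)"
    by (simp add: \<phi>_def a_def \<beta>_def)
qed

end

end

section \<open>Self-expanders with second fundamental form of constant norm\<close>

text \<open>
The projection to the tangent plane at \<open>u\<close> has invertible differential at \<open>u\<close>, hence near \<open>u\<close>, and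
the columns of the inverse Jacobian matrix are the required fields.
\<close>

lemma exists_adapted_graph:
  fixes f :: "real^2 \<Rightarrow> real^3"
  assumes S: "open S" "u \<in> S" and f: "smooth_on f S"
    and inj: "\<And>x. x \<in> S \<Longrightarrow> inj (frechet_derivative f (at x))"
  obtains S' X1 X2 b1 b2 where "u \<in> S'" "S' \<subseteq> S" "adapted_graph S' X1 X2 f b1 b2 (unit_normal f u)"
proof -
  let ?e1 = "axis 1 1 :: real^2" and ?e2 = "axis 2 1 :: real^2"
  define n where "n = unit_normal f u"
  define T where "T = coord_tangent f u"
  have diff: "f differentiable (at x)" if "x \<in> S" for x
    using smooth_on_differentiable[OF f S(1) that] .
  note un = unit_normal_facts[OF diff[OF S(2)] inj[OF S(2)], folded n_def, folded T_def]
  define b1 where "b1 = sgn (T 1)"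
  define b2 where "b2 = cross3 n b1"
  have T1: "T 1 \<noteq> 0" using un(1) by auto
  have b11: "b1 \<bullet> b1 = 1" using T1 by (simp add: b1_def sgn_div_norm dot_square_norm power2_eq_square)
  have b1n: "b1 \<bullet> n = 0" using un(3)[of 1] by (simp add: b1_def sgn_div_norm)
  have b2: "b2 \<bullet> b2 = 1"
    using norm_cross_dot[of n b1] b11 un(2) b1n
    unfolding power_mult_distrib power2_norm_eq_inner b2_def by (simp add: inner_commute)
  have b12: "b1 \<bullet> b2 = 0" "b2 \<bullet> n = 0" by (simp_all add: b2_def dot_cross_self)
  define h1 h2 where "h1 = (\<lambda>x. f x \<bullet> b1)" and "h2 = (\<lambda>x. f x \<bullet> b2)"
  have h: "smooth_on h1 S" "smooth_on h2 S"
    unfolding h1_def h2_def by (rule smooth_on_inner[OF S(1) f])+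
  define d where "d = (\<lambda>(h :: real^2 \<Rightarrow> real) v x. frechet_derivative h (at x) v)"
  have d: "smooth_on (d h1 v) S" "smooth_on (d h2 v) S" for v
    unfolding d_def by (rule smooth_on_frechet_derivative[OF h(1)] smooth_on_frechet_derivative[OF h(2)])+
  define J where "J = (\<lambda>x. d h1 ?e1 x * d h2 ?e2 x - d h1 ?e2 x * d h2 ?e1 x)"
  have J: "smooth_on J S"
    unfolding J_def by (intro smooth_on_diff smooth_on_mult d S(1))
  define S' where "S' = S \<inter> J -` (- {0})"
  have S': "open S'"
    unfolding S'_def
    by (intro continuous_open_preimage smooth_on_continuous_on J S(1)) (simp add: open_Compl)
  have sub: "S' \<subseteq> S" by (auto simp: S'_def)
  have J0: "J x \<noteq> 0" if "x \<in> S'" for x using that by (auto simp: S'_def)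
  note sub_smooth = smooth_on_subset[OF _ sub]
  have invJ: "smooth_on (\<lambda>x. inverse (J x)) S'"
    by (rule smooth_on_inverse[OF S' sub_smooth[OF J] J0])
  \<comment> \<open>The columns of the inverse of the Jacobian matrix of \<open>(h1, h2)\<close>, by Cramer's rule.\<close>
  define X1 :: "real^2 \<Rightarrow> real^2" where
    "X1 = (\<lambda>x. vector [d h2 ?e2 x * inverse (J x), - d h2 ?e1 x * inverse (J x)])"
  define X2 :: "real^2 \<Rightarrow> real^2" where
    "X2 = (\<lambda>x. vector [- d h1 ?e2 x * inverse (J x), d h1 ?e1 x * inverse (J x)])"
  have dh: "d h1 v x = frechet_derivative f (at x) v \<bullet> b1" "d h2 v x = frechet_derivative f (at x) v \<bullet> b2"
    if "x \<in> S" for x v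
    unfolding d_def h1_def h2_def
    by (rule frechet_derivative_linear[OF bounded_linear_inner_left diff[OF that]])+
  have "u \<in> S'"
  proof -
    have dT: "d h1 ?e1 u = T 1 \<bullet> b1" "d h1 ?e2 u = T 2 \<bullet> b1" "d h2 ?e1 u = T 1 \<bullet> b2" "d h2 ?e2 u = T 2 \<bullet> b2"
      using dh[OF S(2)] by (simp_all add: T_def coord_tangent_def)
    have T1b: "T 1 = norm (T 1) *\<^sub>R b1" using T1 by (simp add: b1_def sgn_div_norm)
    have T1b': "T 1 \<bullet> b1 = norm (T 1)" "T 1 \<bullet> b2 = 0"
      by (subst T1b, simp add: b11 b12)+
    have "T 2 \<bullet> b2 \<noteq> 0"
    proof
      assume z: "T 2 \<bullet> b2 = 0"
      have "T 2 \<bullet> n = 0" by (rule un(3))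
      have "v \<bullet> (T 2 - (T 2 \<bullet> b1) *\<^sub>R b1) = 0" for v
        by (subst orthonormal_inner_expand[OF b11 b2 un(2) b12(1) b1n b12(2)])
          (simp add: inner_diff_left z \<open>T 2 \<bullet> n = 0\<close> b11 b12 b1n)
      then have "T 2 = (T 2 \<bullet> b1) *\<^sub>R b1" by (metis inner_eq_zero_iff right_minus_eq)
      then have "cross3 (T 1) (T 2) = 0"
        by (subst T1b) (metis cross_mult_left cross_mult_right cross_refl scaleR_zero_right)
      then show False using un(1) by simp
    qed
    then have "J u \<noteq> 0" unfolding J_def dT T1b' using T1 by simp
    then show ?thesis using S(2) by (simp add: S'_def)
  qed
  moreover have "adapted_graph S' X1 X2 f b1 b2 n"
  proof
    show "open S'" by (rule S')
    show "smooth_on f S'" by (rule sub_smooth[OF f])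
    show "smooth_on (\<lambda>x. f x \<bullet> b1) S'" "smooth_on (\<lambda>x. f x \<bullet> b2) S'"
      using sub_smooth[OF h(1)] sub_smooth[OF h(2)] unfolding h1_def h2_def .
    have sX: "smooth_on (\<lambda>x. d h2 ?e2 x * inverse (J x)) S'" "smooth_on (\<lambda>x. - d h2 ?e1 x * inverse (J x)) S'"
      "smooth_on (\<lambda>x. - d h1 ?e2 x * inverse (J x)) S'" "smooth_on (\<lambda>x. d h1 ?e1 x * inverse (J x)) S'"
      by (intro smooth_on_mult smooth_on_minus S' invJ sub_smooth[OF d(1)] sub_smooth[OF d(2)])+
    show "smooth_on (\<lambda>x. X1 x $ i) S'" "smooth_on (\<lambda>x. X2 x $ i) S'" for i
      using exhaust_2[of i] sX by (auto simp: X1_def X2_def)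
    show "inj (frechet_derivative f (at x))" if "x \<in> S'" for x using that sub inj by blast
    fix x assume x: "x \<in> S'"
    then have xS: "x \<in> S" using sub by blast
    have c: "lie X h x = X x $ 1 * d h ?e1 x + X x $ 2 * d h ?e2 x" if "smooth_on h S" for X h
      using frechet_derivative_coords[OF smooth_on_differentiable[OF that S(1) xS], of "X x"]
      unfolding lie_def d_def real_scaleR_def .
    have "lie X1 h1 x = 1 \<and> lie X1 h2 x = 0 \<and> lie X2 h1 x = 0 \<and> lie X2 h2 x = 1"
      unfolding c[OF h(1)] c[OF h(2)] X1_def X2_def using J0[OF x]
      by (simp add: field_simps) (simp add: J_def algebra_simps)
    then show "lie X1 (\<lambda>x. f x \<bullet> b1) x = 1" "lie X1 (\<lambda>x. f x \<bullet> b2) x = 0"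
      "lie X2 (\<lambda>x. f x \<bullet> b1) x = 0" "lie X2 (\<lambda>x. f x \<bullet> b2) x = 1"
      unfolding h1_def h2_def by auto
  qed (use b11 b1n b2 b12 un(2) in auto)
  ultimately show ?thesis using that[of S'] sub unfolding n_def by blast
qed

text \<open>
The criticality hypothesis says that the position vector is normal at \<open>u\<close>. Written as a graph over
its tangent plane there, the surface satisfies \<open>expander_graph_sff_norm_zero\<close>: the factor \<open>\<beta>\<close>, the cosine of the
angle between the normals at \<open>x\<close> and at \<open>u\<close>, relates the curvatures to the unnormalised
expressions in \<open>w\<close>, and \<open>\<beta> wt\<close> is the support function of the surface.
\<close>

lemma expander_sff_norm_zero_at_critical_point:
  fixes f :: "real^2 \<Rightarrow> real^3"
  assumes S: "open S" "u \<in> S" and f: "smooth_on f S"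
    and inj: "\<And>x. x \<in> S \<Longrightarrow> inj (frechet_derivative f (at x))"
    and expander: "\<And>x. x \<in> S \<Longrightarrow> mean_curvature_vector f x = (1/2) *\<^sub>R normal_part f x (f x)"
    and norm: "\<And>x. x \<in> S \<Longrightarrow> sff_norm f x = a"
    and scal: "scalar_curvature f u \<le> 0"
    and crit: "\<And>i. f u \<bullet> coord_tangent f u i = 0"
  shows "a = 0"
proof -
  obtain S' X1 X2 b1 b2 where u: "u \<in> S'" and sub: "S' \<subseteq> S"
    and ag: "adapted_graph S' X1 X2 f b1 b2 (unit_normal f u)"
    using exists_adapted_graph[OF S f inj] by blast
  define n0 where "n0 = unit_normal f u"
  interpret adapted_graph S' X1 X2 f b1 b2 n0 using ag unfolding n0_def .
  define \<beta> q wt where "\<beta> = (\<lambda>x. unit_normal f x \<bullet> n0)"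
    and "q = (\<lambda>x. 1 + lie X1 w x * lie X1 w x + lie X2 w x * lie X2 w x)"
    and "wt = (\<lambda>x. w x - f x \<bullet> b1 * lie X1 w x - f x \<bullet> b2 * lie X2 w x)"
  have \<phi>: "mean_curvature_vector f x \<bullet> unit_normal f x = \<beta> x * wt x / 2" if x: "x \<in> S'" for x
  proof -
    let ?n = "unit_normal f x"
    have nn: "?n \<bullet> ?n = 1" by (rule unit_normal_facts(2)[OF diff_f[OF x] inj_f[OF x]])
    have "mean_curvature_vector f x \<bullet> ?n = (f x \<bullet> ?n) / 2"
      unfolding expander[OF subsetD[OF sub x]] normal_part_def inner_scaleR_left nn by simp
    also have "f x \<bullet> ?n = \<beta> x * wt x"
      unfolding inner_expand[of "f x" ?n] graph_normal(1,2)[OF x] wt_def \<beta>_def w_def by (simp add: algebra_simps)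
    finally show ?thesis .
  qed
  have \<beta>q: "(\<beta> x)\<^sup>2 * q x = 1" if "x \<in> S'" for x
    unfolding \<beta>_def q_def by (rule graph_normal(3)[OF that])
  have \<beta>0: "\<beta> x \<noteq> 0" if "x \<in> S'" for x using \<beta>q[OF that] by auto
  note curv = graph_curvature_equations
  have qx: "1 + lie X1 w x * lie X1 w x + lie X2 w x * lie X2 w x = q x" for x by (simp add: q_def)
  have \<beta>x: "unit_normal f x \<bullet> n0 = \<beta> x" for x by (simp add: \<beta>_def)
  have w0: "lie X w u = 0" for X
    by (rule graph_tangent[OF u n0_def])
  have h0: "f u \<bullet> b1 = 0" "f u \<bullet> b2 = 0"
  proof -
    have D: "f u \<bullet> frechet_derivative f (at u) v = 0" for v
      unfolding frechet_derivative_coords[OF diff_f[OF u], of v] inner_add_right inner_scaleR_right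
      using crit by (simp add: coord_tangent_def)
    have c: "frechet_derivative f (at u) (X u) \<bullet> n0 = 0" for X
      using w0[of X] unfolding w_def[abs_def] lie_inner[OF u] .
    show "f u \<bullet> b1 = 0" "f u \<bullet> b2 = 0"
      using D[of "X1 u"] D[of "X2 u"] dual[OF u, unfolded lie_inner[OF u]]
        inner_expand[of "f u" "frechet_derivative f (at u) (X1 u)"]
        inner_expand[of "f u" "frechet_derivative f (at u) (X2 u)"] by (simp_all add: c)
  qed
  \<comment> \<open>The powers of \<open>\<beta>\<close> cancel by \<open>\<beta>\<^sup>2 q = 1\<close>.\<close>
  have solve: "8 * k = t * t * r - 4 * c * (r * r)"
    if "c * r = (b * t / 2)\<^sup>2 * r - 2 * b\<^sup>2 * k" "b\<^sup>2 * r = 1" for b t r c k :: real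
  proof -
    have "4 * (c * r) = (b * t)\<^sup>2 * r - 8 * b\<^sup>2 * k"
      unfolding that(1) by (simp add: power_divide algebra_simps)
    then show ?thesis using that(2) by algebra
  qed
  show "a = 0"
  proof (rule expander_graph_sff_norm_zero[OF smooth_w u])
    fix x assume x: "x \<in> S'"
    let ?w1 = "lie X1 w x" and ?w2 = "lie X2 w x"
    let ?w11 = "lie X1 (lie X1 w) x" and ?w12 = "lie X1 (lie X2 w) x" and ?w22 = "lie X2 (lie X2 w) x"
    have "\<beta> x * (wt x * q x) = \<beta> x * (2 * ((1 + ?w1 * ?w1) * ?w22 - 2 * (?w1 * ?w2 * ?w12) + (1 + ?w2 * ?w2) * ?w11))"
    proof -
      have half: "b * (t * k) = b * (2 * k')" if "b * t / 2 * k = b * k'" for b t k k' :: real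
        using that by auto
      show ?thesis
        by (rule half) (use curv(1)[OF x] in \<open>simp only: \<phi>[OF x] \<beta>x qx\<close>)
    qed
    then show "(w x - f x \<bullet> b1 * ?w1 - f x \<bullet> b2 * ?w2) * (1 + ?w1 * ?w1 + ?w2 * ?w2) =
      2 * ((1 + ?w1 * ?w1) * ?w22 - 2 * (?w1 * ?w2 * ?w12) + (1 + ?w2 * ?w2) * ?w11)"
      using \<beta>0[OF x] unfolding wt_def q_def by simp
    have "a\<^sup>2 * q x = (\<beta> x * wt x / 2)\<^sup>2 * q x - 2 * (\<beta> x)\<^sup>2 * (?w11 * ?w22 - ?w12 * ?w12)"
      using curv(2)[OF x] unfolding norm[OF subsetD[OF sub x]] \<phi>[OF x] \<beta>x qx .
    from solve[OF this \<beta>q[OF x]]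
    have "8 * (?w11 * ?w22 - ?w12 * ?w12) = wt x * wt x * q x - 4 * a\<^sup>2 * (q x * q x)" .
    then show "8 * (?w11 * ?w22 - ?w12 * ?w12) = 
      (w x - f x \<bullet> b1 * ?w1 - f x \<bullet> b2 * ?w2) * (w x - f x \<bullet> b1 * ?w1 - f x \<bullet> b2 * ?w2)
        * (1 + ?w1 * ?w1 + ?w2 * ?w2)
      - 4 * a\<^sup>2 * ((1 + ?w1 * ?w1 + ?w2 * ?w2) * (1 + ?w1 * ?w1 + ?w2 * ?w2))"
      unfolding wt_def q_def .
  next
    let ?K = "lie X1 (lie X1 w) u * lie X2 (lie X2 w) u - lie X1 (lie X2 w) u * lie X1 (lie X2 w) u"
    let ?\<phi> = "mean_curvature_vector f u \<bullet> unit_normal f u"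
    have "2 * (\<beta> u)\<^sup>2 * ?K = (?\<phi>\<^sup>2 - (sff_norm f u)\<^sup>2) * q u"
      using curv(2)[OF u] unfolding \<beta>x qx by (simp add: algebra_simps)
    moreover have "?\<phi>\<^sup>2 - (sff_norm f u)\<^sup>2 \<le> 0"
      using scal by (simp add: scalar_curvature_def mean_curvature_def)
    moreover have "q u > 0" unfolding q_def by (simp add: w0)
    ultimately have "2 * (\<beta> u)\<^sup>2 * ?K \<le> 0" by (simp add: mult_nonpos_nonneg)
    moreover have "2 * (\<beta> u)\<^sup>2 > 0" using \<beta>0[OF u] by simp
    ultimately show "?K \<le> 0" by (metis mult_le_0_iff not_le)
  qed (use h0 w0 in auto)
qed

lemma (in dual_fields) derivative_zero:
  assumes m: "smooth_on m S" and x: "x \<in> S" and zero: "lie X1 m x = 0" "lie X2 m x = 0"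
  shows "(m has_derivative (\<lambda>_. 0)) (at x)"
proof -
  let ?d1 = "lie (\<lambda>_. axis 1 1)" and ?d2 = "lie (\<lambda>_. axis 2 1)"
  note d = dual(1)[OF x, unfolded lie_coords[OF smooth_h(1) x, of X1]]
    dual(2)[OF x, unfolded lie_coords[OF smooth_h(2) x, of X1]]
    dual(3)[OF x, unfolded lie_coords[OF smooth_h(1) x, of X2]]
    dual(4)[OF x, unfolded lie_coords[OF smooth_h(2) x, of X2]]
  note z = zero(1)[unfolded lie_coords[OF m x, of X1]] zero(2)[unfolded lie_coords[OF m x, of X2]]
  have "V = 0 \<and> W = 0"
    if "x1 * a + x2 * b = 1" "x1 * c + x2 * d = 0" "y1 * a + y2 * b = 0" "y1 * c + y2 * d = 1"
      "x1 * V + x2 * W = 0" "y1 * V + y2 * W = 0" for x1 x2 y1 y2 a b c d V W :: real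
    using that by algebra
  from this[OF d z] have "frechet_derivative m (at x) v = 0" for v
    using frechet_derivative_coords[OF diff[OF m x], of v] by (simp add: lie_def)
  then have "frechet_derivative m (at x) = (\<lambda>_. 0)" by (simp add: fun_eq_iff)
  then show ?thesis using has_frechet_derivative[OF diff[OF m x]] by simp
qed

text \<open>
When the second fundamental form vanishes, so does the Hessian of the height \<open>w\<close> over the tangent plane
at \<open>u\<close>. Since \<open>w\<close> is critical at \<open>u\<close>, it is constant, and the constant is \<open>0\<close> because the self-expander
equation without mean curvature makes the position vector tangential.
\<close>

lemma flat_expander_locally_in_plane:
  fixes f :: "real^2 \<Rightarrow> real^3"
  assumes S: "open S" "u \<in> S" and f: "smooth_on f S"
    and inj: "\<And>x. x \<in> S \<Longrightarrow> inj (frechet_derivative f (at x))"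
    and expander: "\<And>x. x \<in> S \<Longrightarrow> mean_curvature_vector f x = (1/2) *\<^sub>R normal_part f x (f x)"
    and norm: "\<And>x. x \<in> S \<Longrightarrow> sff_norm f x = 0"
  obtains r where "r > 0" "ball u r \<subseteq> S" "\<And>x. x \<in> ball u r \<Longrightarrow> f x \<bullet> unit_normal f u = 0"
proof -
  obtain S' X1 X2 b1 b2 where u: "u \<in> S'" and sub: "S' \<subseteq> S"
    and ag: "adapted_graph S' X1 X2 f b1 b2 (unit_normal f u)"
    using exists_adapted_graph[OF S f inj] by blast
  define n0 where "n0 = unit_normal f u"
  interpret adapted_graph S' X1 X2 f b1 b2 n0 using ag unfolding n0_def .
  have L: "second_deriv f x 1 1 \<bullet> unit_normal f x = 0" "second_deriv f x 1 2 \<bullet> unit_normal f x = 0"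
    "second_deriv f x 2 2 \<bullet> unit_normal f x = 0" and
    H: "mean_curvature_vector f x \<bullet> unit_normal f x = 0" if x: "x \<in> S'" for x
  proof -
    note c = curvature_coords[OF diff_f[OF x] inj_f[OF x] second_deriv_commute[OF smooth_f open_S x]]
    show z: "second_deriv f x 1 1 \<bullet> unit_normal f x = 0" "second_deriv f x 1 2 \<bullet> unit_normal f x = 0"
      "second_deriv f x 2 2 \<bullet> unit_normal f x = 0"
      using c(4) norm[of x] x sub by auto
    show "mean_curvature_vector f x \<bullet> unit_normal f x = 0"
      using c(1,2) unfolding z by simp
  qed
  have w2: "lie X (lie Y w) x = 0" if "x \<in> S'" "frame_field X" "frame_field Y" for X Y x
    using graph_second_form[OF that] graph_normal(3)[OF that(1)] unfolding L[OF that(1)] by auto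
  obtain r where r: "r > 0" "ball u r \<subseteq> S'" using open_S u openE by blast
  have const: "m x = m u"
    if "smooth_on m S'" "\<And>x. x \<in> S' \<Longrightarrow> lie X1 m x = 0" "\<And>x. x \<in> S' \<Longrightarrow> lie X2 m x = 0"
      "x \<in> ball u r" for m x
  proof -
    have "(m has_derivative (\<lambda>_. 0)) (at x within ball u r)" if "x \<in> ball u r" for x
      using derivative_zero[OF \<open>smooth_on m S'\<close>] that r(2) \<open>\<And>x. x \<in> S' \<Longrightarrow> lie X1 m x = 0\<close>
        \<open>\<And>x. x \<in> S' \<Longrightarrow> lie X2 m x = 0\<close> by (blast intro: has_derivative_at_withinI)
    then obtain c where "\<And>x. x \<in> ball u r \<Longrightarrow> m x = c"
      using has_derivative_zero_constant[OF convex_ball, of u r m] by blast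
    then show ?thesis using \<open>x \<in> ball u r\<close> r(1) by simp
  qed
  have w0: "lie X w u = 0" for X
    by (rule graph_tangent[OF u n0_def])
  have w1: "lie X w x = 0" if "x \<in> ball u r" "frame_field X" for X x
    using const[OF smooth_lie[OF that(2) smooth_w] w2 w2 that(1)] that(2) w0 by simp
  have "f u \<bullet> n0 = 0"
    using expander[OF S(2)] H[OF u] unit_normal_facts(2)[OF diff_f[OF u] inj_f[OF u]]
    by (simp add: normal_part_def n0_def)
  have "w x = 0" if "x \<in> ball u r" for x
  proof -
    have "(w has_derivative (\<lambda>_. 0)) (at x within ball u r)" if "x \<in> ball u r" for x
      using derivative_zero[OF smooth_w subsetD[OF r(2) that] w1[OF that] w1[OF that]]
      by (simp add: has_derivative_at_withinI)
    then obtain c where "\<And>x. x \<in> ball u r \<Longrightarrow> w x = c"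
      using has_derivative_zero_constant[OF convex_ball, of u r w] by blast
    then show ?thesis using that r(1) \<open>f u \<bullet> n0 = 0\<close> by (simp add: w_def)
  qed
  then have "f x \<bullet> unit_normal f u = 0" if "x \<in> ball u r" for x
    using that unfolding n0_def[symmetric] by (simp add: w_def)
  then show ?thesis using that[OF r(1) order_trans[OF r(2) sub]] by blast
qed

section \<open>Proper local homeomorphisms onto Euclidean space\<close>

text \<open>
A proper local homeomorphism is a covering, and a connected covering of a simply connected space is
trivial. For Euclidean space this is shown directly, by extending a continuous section from a ball to
larger and larger concentric balls. This works for a topology on an arbitrary carrier set.
\<close>

locale proper_local_homeo =
  fixes X :: "'a topology" and F :: "'a \<Rightarrow> 'b::euclidean_space"
  assumes Hausdorff: "Hausdorff_space X" and conn: "connected_space X"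
    and proper: "\<And>K. compact K \<Longrightarrow> compactin X {p \<in> topspace X. F p \<in> K}"
    and local_homeo: "\<And>p. p \<in> topspace X \<Longrightarrow> \<exists>W. openin X W \<and> p \<in> W \<and> open (F ` W) \<and>
      homeomorphic_map (subtopology X W) (top_of_set (F ` W)) F"
begin

definition is_section :: "'b set \<Rightarrow> ('b \<Rightarrow> 'a) \<Rightarrow> bool" where
  "is_section U s \<longleftrightarrow> continuous_map (top_of_set U) X s \<and> (\<forall>y\<in>U. F (s y) = y)"

lemma section_in: "is_section U s \<Longrightarrow> y \<in> U \<Longrightarrow> s y \<in> topspace X"
  by (force simp: is_section_def continuous_map_def Pi_iff)

lemma section_subset: "is_section U s \<Longrightarrow> V \<subseteq> U \<Longrightarrow> is_section V s"
  unfolding is_section_def using continuous_map_from_subtopology_mono by blast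

lemma section_open_preimage:
  assumes "is_section U s" "openin X W"
  shows "openin (top_of_set U) {y \<in> U. s y \<in> W}"
  using assms openin_continuous_map_preimage[of "top_of_set U" X s W]
  by (simp add: is_section_def)

lemma local_section:
  assumes "p \<in> topspace X"
  obtains W \<delta> \<sigma> where "openin X W" "p \<in> W" "inj_on F W" "\<delta> > 0"
    "is_section (ball (F p) \<delta>) \<sigma>" "\<sigma> ` ball (F p) \<delta> \<subseteq> W"
proof -
  obtain W where W: "openin X W" "p \<in> W" "open (F ` W)"
    and hom: "homeomorphic_map (subtopology X W) (top_of_set (F ` W)) F"
    using local_homeo[OF assms] by blast
  have tW: "topspace (subtopology X W) = W" using W(1) openin_subset by (auto simp: topspace_subtopology)
  obtain \<sigma> where \<sigma>: "homeomorphic_maps (subtopology X W) (top_of_set (F ` W)) F \<sigma>"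
    using hom homeomorphic_map_maps by blast
  then have c: "continuous_map (top_of_set (F ` W)) (subtopology X W) \<sigma>"
    and inv: "\<And>y. y \<in> F ` W \<Longrightarrow> F (\<sigma> y) = y" "\<And>x. x \<in> W \<Longrightarrow> \<sigma> (F x) = x"
    unfolding homeomorphic_maps_def tW by auto
  obtain \<delta> where \<delta>: "\<delta> > 0" "ball (F p) \<delta> \<subseteq> F ` W"
    using W(2,3) openE[of "F ` W" "F p"] by blast
  show ?thesis
  proof (rule that[OF W(1,2) _ \<delta>(1)])
    show "inj_on F W" using inv(2) by (rule inj_on_inverseI)
    have "is_section (F ` W) \<sigma>"
      unfolding is_section_def using c inv(1) by (simp add: continuous_map_in_subtopology)
    then show "is_section (ball (F p) \<delta>) \<sigma>" by (rule section_subset) (rule \<delta>(2))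
    show "\<sigma> ` ball (F p) \<delta> \<subseteq> W" using \<delta>(2) inv(2) by auto
  qed
qed

lemma continuous_F: "continuous_map X euclidean F"
proof -
  let ?I = "{W. openin X W \<and> homeomorphic_map (subtopology X W) (top_of_set (F ` W)) F}"
  show ?thesis
  proof (rule pasting_lemma[where I = ?I and T = "\<lambda>W. W" and f = "\<lambda>_. F"])
    show "continuous_map (subtopology X W) euclidean F" if "W \<in> ?I" for W
      using that homeomorphic_imp_continuous_map continuous_map_in_subtopology by blast
    show "\<exists>W. W \<in> ?I \<and> p \<in> W \<and> F p = F p" if "p \<in> topspace X" for p
      using local_homeo[OF that] by blast
  qed auto
qed

lemma injective_neighbourhood:
  assumes "p \<in> topspace X"
  shows "\<exists>W. openin X W \<and> p \<in> W \<and> inj_on F W"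
  using local_section[OF assms] by metis

lemma section_unique:
  assumes s: "is_section U s" and t: "is_section U t" and U: "connected U"
    and y0: "y0 \<in> U" "s y0 = t y0" and y: "y \<in> U"
  shows "s y = t y"
proof -
  let ?A = "{y \<in> U. s y = t y}"
  have "closedin (top_of_set U) {y \<in> topspace (top_of_set U). s y = t y}"
    using s t Hausdorff unfolding is_section_def by (intro closedin_continuous_maps_eq) auto
  then have cl: "closedin (top_of_set U) ?A" by simp
  have op: "openin (top_of_set U) ?A"
  proof (subst openin_subopen, intro ballI)
    fix y assume yA: "y \<in> ?A"
    obtain W where W: "openin X W" "s y \<in> W" "inj_on F W"
      using injective_neighbourhood[OF section_in[OF s, of y]] yA by auto
    let ?O = "{z \<in> U. s z \<in> W} \<inter> {z \<in> U. t z \<in> W}"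
    have "openin (top_of_set U) ?O"
      by (intro openin_Int section_open_preimage s t W(1))
    moreover have "y \<in> ?O" using yA W(2) by auto
    moreover have "?O \<subseteq> ?A"
    proof
      fix z assume z: "z \<in> ?O"
      then have "F (s z) = F (t z)" using s t by (auto simp: is_section_def)
      then show "z \<in> ?A" using z W(3) by (auto dest: inj_onD)
    qed
    ultimately show "\<exists>T. openin (top_of_set U) T \<and> y \<in> T \<and> T \<subseteq> ?A" by blast
  qed
  have "?A = {} \<or> ?A = U" using U cl op unfolding connected_clopen by blast
  then show ?thesis using y0 y by blast
qed

lemma section_paste:
  assumes op: "\<And>i. i \<in> I \<Longrightarrow> open (T i)" and s: "\<And>i. i \<in> I \<Longrightarrow> is_section (T i) (f i)"
    and agree: "\<And>i j y. i \<in> I \<Longrightarrow> j \<in> I \<Longrightarrow> y \<in> T i \<Longrightarrow> y \<in> T j \<Longrightarrow> f i y = f j y"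
  obtains g where "is_section (\<Union>i\<in>I. T i) g" "\<And>i y. i \<in> I \<Longrightarrow> y \<in> T i \<Longrightarrow> g y = f i y"
proof -
  let ?U = "\<Union>i\<in>I. T i"
  obtain g where g: "continuous_map (top_of_set ?U) X g"
    "\<And>y i. \<lbrakk>i \<in> I; y \<in> topspace (top_of_set ?U) \<inter> T i\<rbrakk> \<Longrightarrow> g y = f i y"
  proof (rule pasting_lemma_exists[where X = "top_of_set ?U" and I = I and T = T and Y = X and f = f])
    show "topspace (top_of_set ?U) \<subseteq> ?U" by simp
    show "openin (top_of_set ?U) (T i)" if "i \<in> I" for i
      using that op by (auto intro: open_subset)
    show "continuous_map (subtopology (top_of_set ?U) (T i)) X (f i)" if i: "i \<in> I" for i
    proof -
      have "?U \<inter> T i = T i" using i by blast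
      then show ?thesis using s[OF i] unfolding is_section_def subtopology_subtopology by simp
    qed
    show "f i x = f j x" if "i \<in> I" "j \<in> I" "x \<in> topspace (top_of_set ?U) \<inter> T i \<inter> T j" for i j x
      using agree that by blast
  qed blast
  show ?thesis
  proof (rule that[of g])
    show eq: "g y = f i y" if "i \<in> I" "y \<in> T i" for i y using g(2) that by auto
    show "is_section ?U g"
      unfolding is_section_def using g(1) eq s by (auto simp: is_section_def)
  qed
qed

text \<open>
By properness the values of \<open>s\<close> near \<open>v\<close> stay in a compact set, so they have a cluster point \<open>q\<close>, which
lies over \<open>v\<close>. A local section through \<open>q\<close> meets \<open>s\<close> near \<open>v\<close>, and it agrees with \<open>s\<close> on the whole
overlap of the two balls because that is convex.
\<close>

lemma section_extends_at_boundary: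
  assumes s: "is_section (ball c R) s" and R: "R > 0" and v: "dist c v = R"
  obtains \<delta> \<sigma> where "\<delta> > 0" "is_section (ball v \<delta>) \<sigma>"
    "\<And>y. y \<in> ball v \<delta> \<inter> ball c R \<Longrightarrow> \<sigma> y = s y"
proof -
  define C where "C = {p \<in> topspace X. F p \<in> cball c R}"
  have C: "compactin X C" unfolding C_def by (rule proper) simp
  define avoids where "avoids = (\<lambda>Q \<delta>. \<forall>y \<in> ball v \<delta> \<inter> ball c R. s y \<notin> Q)"
  have sC: "s y \<in> C" if "y \<in> ball c R" for y
    using section_in[OF s that] s that by (auto simp: C_def is_section_def)
  have "\<exists>q\<in>C. \<forall>Q \<delta>. openin X Q \<longrightarrow> q \<in> Q \<longrightarrow> \<delta> > 0 \<longrightarrow> \<not> avoids Q \<delta>"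
  proof (rule ccontr)
    assume "\<not> ?thesis"
    then have "\<forall>q\<in>C. \<exists>Q \<delta>. openin X Q \<and> q \<in> Q \<and> \<delta> > 0 \<and> avoids Q \<delta>" by blast
    then obtain Q d where Q: "\<And>q. q \<in> C \<Longrightarrow> openin X (Q q)" "\<And>q. q \<in> C \<Longrightarrow> q \<in> Q q"
      "\<And>q. q \<in> C \<Longrightarrow> (d q :: real) > 0" "\<And>q. q \<in> C \<Longrightarrow> avoids (Q q) (d q)"
      by metis
    have "\<exists>\<F>. finite \<F> \<and> \<F> \<subseteq> Q ` C \<and> C \<subseteq> \<Union>\<F>"
      using C Q(1,2) by (intro compactinD[OF C]) auto
    then obtain C' where C': "finite C'" "C' \<subseteq> C" "C \<subseteq> (\<Union>q\<in>C'. Q q)"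
      by (metis finite_subset_image)
    define \<delta> where "\<delta> = Min (insert R (d ` C'))"
    have \<delta>: "\<delta> > 0" "\<delta> \<le> R" "\<And>q. q \<in> C' \<Longrightarrow> \<delta> \<le> d q"
      using C' Q(3) R by (auto simp: \<delta>_def Min_gr_iff)
    define y where "y = v + (\<delta> / (2 * R)) *\<^sub>R (c - v)"
    have "dist v y < \<delta>" 
      using \<delta> R v by (simp add: y_def dist_norm norm_minus_commute)
    moreover have "dist c y < R"
    proof -
      have "c - y = (1 - \<delta> / (2 * R)) *\<^sub>R (c - v)" by (simp add: y_def algebra_simps)
      then have "dist c y = \<bar>1 - \<delta> / (2 * R)\<bar> * R" using v by (simp add: dist_norm)
      also have "\<dots> < 1 * R"
      proof (rule mult_strict_right_mono[OF _ R])
        have "0 < \<delta> / (2 * R)" "\<delta> / (2 * R) \<le> 1" using \<delta> R by (auto simp: field_simps)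
        then show "\<bar>1 - \<delta> / (2 * R)\<bar> < 1" by linarith
      qed
      finally show ?thesis by simp
    qed
    ultimately have y: "y \<in> ball v \<delta>" "y \<in> ball c R" by auto
    then obtain q where q: "q \<in> C'" "s y \<in> Q q" using sC C'(3) by blast
    have "y \<in> ball v (d q)" using y(1) \<delta>(3)[OF q(1)] by auto
    then show False using Q(4)[of q] q C'(2) y(2) unfolding avoids_def by blast
  qed
  then obtain q where q: "q \<in> C" and cluster: "\<And>Q \<delta>. openin X Q \<Longrightarrow> q \<in> Q \<Longrightarrow> \<delta> > 0 \<Longrightarrow> \<not> avoids Q \<delta>"
    by blast
  have qX: "q \<in> topspace X" using q by (simp add: C_def)
  have Fq: "F q = v"
  proof (rule ccontr)
    assume ne: "F q \<noteq> v"
    let ?r = "dist (F q) v / 2"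
    let ?Q = "{p \<in> topspace X. F p \<in> - cball v ?r}"
    have "openin X ?Q"
      by (rule openin_continuous_map_preimage[OF continuous_F]) (simp add: open_Compl)
    moreover have "q \<in> ?Q" using qX ne by (simp add: dist_commute)
    moreover have "avoids ?Q ?r" using s by (auto simp: avoids_def is_section_def)
    ultimately show False using cluster[of ?Q ?r] ne by simp
  qed
  obtain W \<delta> \<sigma> where W: "openin X W" "q \<in> W" "inj_on F W" and \<delta>: "\<delta> > 0"
    and \<sigma>: "is_section (ball v \<delta>) \<sigma>" "\<sigma> ` ball v \<delta> \<subseteq> W"
    using local_section[OF qX] unfolding Fq by blast
  obtain y0 where y0: "y0 \<in> ball v \<delta> \<inter> ball c R" "s y0 \<in> W"
    using cluster[OF W(1,2) \<delta>] unfolding avoids_def by blast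
  have "F (\<sigma> y0) = F (s y0)" using \<sigma>(1) s y0(1) by (auto simp: is_section_def)
  moreover have "\<sigma> y0 \<in> W" using \<sigma>(2) y0(1) by blast
  ultimately have eq: "\<sigma> y0 = s y0" using W(3) y0(2) by (blast dest: inj_onD)
  have "\<sigma> y = s y" if "y \<in> ball v \<delta> \<inter> ball c R" for y
  proof (rule section_unique[where U = "ball v \<delta> \<inter> ball c R" and s = \<sigma> and t = s and y = y and ?y0.0 = y0])
    show "connected (ball v \<delta> \<inter> ball c R)" by (intro convex_connected convex_Int convex_ball)
    show "is_section (ball v \<delta> \<inter> ball c R) \<sigma>" by (rule section_subset[OF \<sigma>(1)]) simp
    show "is_section (ball v \<delta> \<inter> ball c R) s" by (rule section_subset[OF s]) simp
  qed (use y0(1) eq that in auto)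
  then show ?thesis using that \<delta> \<sigma>(1) by blast
qed

text \<open>
The extensions at two boundary points are compatible: if their balls meet, they meet on the open
segment between the two centres, which lies inside the ball \<open>ball c R\<close>, where both extensions equal \<open>s\<close>.
Compactness of the closed ball then yields a larger concentric ball in the union.
\<close>

lemma section_extends:
  assumes s: "is_section (ball c R) s" and R: "R > 0"
  obtains R' s' where "R' > R" "is_section (ball c R') s'" "s' c = s c"
proof -
  have "\<forall>v\<in>sphere c R. \<exists>\<delta> \<sigma>. \<delta> > 0 \<and> is_section (ball v \<delta>) \<sigma> \<and> (\<forall>y \<in> ball v \<delta> \<inter> ball c R. \<sigma> y = s y)"
    using section_extends_at_boundary[OF s R] by (metis mem_sphere)
  then obtain d \<sigma> where d: "\<And>v. v \<in> sphere c R \<Longrightarrow> (d v :: real) > 0"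
    and \<sigma>: "\<And>v. v \<in> sphere c R \<Longrightarrow> is_section (ball v (d v)) (\<sigma> v)"
    and \<sigma>s: "\<And>v y. v \<in> sphere c R \<Longrightarrow> y \<in> ball v (d v) \<Longrightarrow> y \<in> ball c R \<Longrightarrow> \<sigma> v y = s y"
    by (metis IntI)
  have agree: "\<sigma> v y = \<sigma> v' y"
    if v: "v \<in> sphere c R" "v' \<in> sphere c R" and y: "y \<in> ball v (d v)" "y \<in> ball v' (d v')" for v v' y
  proof (cases "v = v'")
    case False
    \<comment> \<open>This ratio places \<open>z\<close> in both balls, as the sum of the radii exceeds the distance of the centres.\<close>
    define t where "t = d v / (d v + d v')"
    define z where "z = (1 - t) *\<^sub>R v + t *\<^sub>R v'"
    have pos: "d v > 0" "d v' > 0" using d v by auto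
    have D: "dist v v' < d v + d v'" using y dist_triangle2[of v v' y] by (simp add: dist_commute)
    have t: "0 < t" "t < 1" "1 - t = d v' / (d v + d v')"
      using pos by (auto simp: t_def field_simps)
    have less: "a / (a + b) * e < a" if "a > 0" "b > 0" "e < a + b" for a b e :: real
      using that by (simp add: divide_simps)
    have "v - z = t *\<^sub>R (v - v')" by (simp add: z_def algebra_simps)
    then have "dist v z = t * dist v v'" using t by (simp add: dist_norm)
    then have zv: "z \<in> ball v (d v)" using less[OF pos D] by (simp add: t_def)
    have "v' - z = (1 - t) *\<^sub>R (v' - v)" by (simp add: z_def algebra_simps)
    then have "dist v' z = (1 - t) * dist v v'" using t(1,2) by (simp add: dist_norm norm_minus_commute)
    then have zv': "z \<in> ball v' (d v')" using less[OF pos(2,1)] D t(3) by (simp add: add.commute)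
    have "z \<in> open_segment v v'" using False t by (auto simp: in_segment z_def)
    then have zc: "z \<in> ball c R" using dist_decreases_open_segment[of z v v' c] v by auto
    show ?thesis
    proof (rule section_unique[where s = "\<sigma> v" and t = "\<sigma> v'" and y = y and ?y0.0 = z and U = "ball v (d v) \<inter> ball v' (d v')"])
      show "connected (ball v (d v) \<inter> ball v' (d v'))" by (intro convex_connected convex_Int convex_ball)
      show "\<sigma> v z = \<sigma> v' z" using \<sigma>s zv zv' zc v by simp
      show "is_section (ball v (d v) \<inter> ball v' (d v')) (\<sigma> v)"
        by (rule section_subset[OF \<sigma>[OF v(1)]]) simp
      show "is_section (ball v (d v) \<inter> ball v' (d v')) (\<sigma> v')"
        by (rule section_subset[OF \<sigma>[OF v(2)]]) simp
    qed (use y zv zv' in auto)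
  qed simp
  \<comment> \<open>The centre \<open>c\<close>, which is not on the sphere, serves as the index of the given section.\<close>
  define I where "I = insert c (sphere c R)"
  define T where "T = (\<lambda>v. if v = c then ball c R else ball v (d v))"
  define f where "f = (\<lambda>v. if v = c then s else \<sigma> v)"
  have cI: "c \<notin> sphere c R" using R by simp
  obtain g where g: "is_section (\<Union>v\<in>I. T v) g" "\<And>v y. v \<in> I \<Longrightarrow> y \<in> T v \<Longrightarrow> g y = f v y"
  proof (rule section_paste[of I T f])
    show "open (T i)" for i by (simp add: T_def)
    show "is_section (T i) (f i)" if "i \<in> I" for i using that s \<sigma> by (auto simp: T_def f_def I_def)
    show "f i y = f j y" if "i \<in> I" "j \<in> I" "y \<in> T i" "y \<in> T j" for i j y
      using that agree[of i j y] \<sigma>s[of i y] \<sigma>s[of j y]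
      by (auto simp: T_def f_def I_def split: if_splits)
  qed blast
  have cover: "cball c R \<subseteq> (\<Union>v\<in>I. T v)"
  proof
    fix y assume y: "y \<in> cball c R"
    show "y \<in> (\<Union>v\<in>I. T v)"
    proof (cases "dist c y = R")
      case True
      then have "y \<in> I" "y \<in> T y" using d cI by (auto simp: I_def T_def)
      then show ?thesis by blast
    next
      case False
      then have "y \<in> T c" using y by (auto simp: T_def)
      then show ?thesis by (auto simp: I_def)
    qed
  qed
  have "open (\<Union>v\<in>I. T v)" by (auto simp: T_def)
  then obtain e where e: "e > 0" "{x. infdist x (cball c R) \<le> e} \<subseteq> (\<Union>v\<in>I. T v)"
    using compact_in_open_separated[OF _ _ _ cover] R by auto
  have "ball c (R + e) \<subseteq> {x. infdist x (cball c R) \<le> e}"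
  proof
    fix x assume x: "x \<in> ball c (R + e)"
    show "x \<in> {x. infdist x (cball c R) \<le> e}"
    proof (cases "dist c x \<le> R")
      case True
      then show ?thesis using e by simp
    next
      case False
      define z where "z = c + (R / dist c x) *\<^sub>R (x - c)"
      have pos: "dist c x > 0" using False R by linarith
      have "dist c z = R" using pos R by (simp add: z_def dist_norm norm_minus_commute)
      then have "infdist x (cball c R) \<le> dist x z" by (intro infdist_le) simp
      also have "x - z = (1 - R / dist c x) *\<^sub>R (x - c)" by (simp add: z_def algebra_simps)
      then have "dist x z = \<bar>1 - R / dist c x\<bar> * dist c x" by (simp add: dist_norm norm_minus_commute)
      also have "\<bar>1 - R / dist c x\<bar> * dist c x = dist c x - R"
        using False pos R by (simp add: field_simps)
      finally show ?thesis using x by simp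
    qed
  qed
  then have "is_section (ball c (R + e)) g" using section_subset[OF g(1)] e(2) by blast
  moreover have "g c = s c" using g(2)[of c c] R by (simp add: I_def T_def f_def)
  ultimately show ?thesis using that[of "R + e" g] e(1) by simp
qed

text \<open>
Sections that agree at \<open>c\<close> agree on concentric balls, so they fit together. If the radii were bounded,
the union would be a ball to which \<open>section_extends\<close> applies.
\<close>

lemma global_section:
  assumes p: "p \<in> topspace X"
  obtains s where "is_section UNIV s"
proof -
  define c where "c = F p"
  define \<R> where "\<R> = {R. R > 0 \<and> (\<exists>s. is_section (ball c R) s \<and> s c = p)}"
  have "\<exists>R. R \<in> \<R>"
  proof -
    obtain W \<delta> \<sigma> where W: "p \<in> W" "inj_on F W" "\<delta> > 0"
      "is_section (ball (F p) \<delta>) \<sigma>" "\<sigma> ` ball (F p) \<delta> \<subseteq> W"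
      using local_section[OF p] by metis
    have "F (\<sigma> c) = F p" "\<sigma> c \<in> W" using W(3-5) by (auto simp: c_def is_section_def)
    then have "\<sigma> c = p" using W(1,2) by (auto dest: inj_onD)
    then have "\<delta> \<in> \<R>" using W(3,4) unfolding \<R>_def c_def mem_Collect_eq by metis
    then show ?thesis ..
  qed
  obtain s where s: "\<And>R. R \<in> \<R> \<Longrightarrow> is_section (ball c R) (s R)" "\<And>R. R \<in> \<R> \<Longrightarrow> s R c = p"
  proof -
    have "\<forall>R\<in>\<R>. \<exists>s. is_section (ball c R) s \<and> s c = p" by (simp add: \<R>_def)
    then show ?thesis using that by metis
  qed
  have pos: "R > 0" if "R \<in> \<R>" for R using that by (simp add: \<R>_def)
  obtain g where g: "is_section (\<Union>R\<in>\<R>. ball c R) g" "\<And>R y. R \<in> \<R> \<Longrightarrow> y \<in> ball c R \<Longrightarrow> g y = s R y"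
  proof (rule section_paste[of \<R> "ball c" s])
    show "s i y = s j y" if "i \<in> \<R>" "j \<in> \<R>" "y \<in> ball c i" "y \<in> ball c j" for i j y
    proof (rule section_unique[where s = "s i" and t = "s j" and y = y and ?y0.0 = c and U = "ball c i \<inter> ball c j"])
      show "connected (ball c i \<inter> ball c j)" by (intro convex_connected convex_Int convex_ball)
      show "is_section (ball c i \<inter> ball c j) (s i)"
        by (rule section_subset[OF s(1)[OF that(1)]]) simp
      show "is_section (ball c i \<inter> ball c j) (s j)"
        by (rule section_subset[OF s(1)[OF that(2)]]) simp
    qed (use that s pos in auto)
  qed (use s in auto)
  have "\<not> bdd_above \<R>"
  proof
    assume bdd: "bdd_above \<R>"
    obtain R0 where R0: "R0 \<in> \<R>" using \<open>\<exists>R. R \<in> \<R>\<close> by blast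
    have le: "R \<le> Sup \<R>" if "R \<in> \<R>" for R using that bdd by (rule cSup_upper)
    have "ball c (Sup \<R>) \<subseteq> (\<Union>R\<in>\<R>. ball c R)"
      using less_cSup_iff[OF _ bdd] R0 by force
    then have "is_section (ball c (Sup \<R>)) g" using section_subset[OF g(1)] by blast
    moreover have "Sup \<R> > 0" using le[OF R0] pos[OF R0] by linarith
    moreover have "g c = p" using g(2)[OF R0, of c] s(2)[OF R0] pos[OF R0] by simp
    ultimately obtain R' s' where "R' > Sup \<R>" "is_section (ball c R') s'" "s' c = p"
      using section_extends[of c "Sup \<R>" g] by metis
    then have "R' \<in> \<R>" using \<open>Sup \<R> > 0\<close> by (auto simp: \<R>_def)
    then show False using le \<open>R' > Sup \<R>\<close> by force
  qed
  then have "(\<Union>R\<in>\<R>. ball c R) = UNIV"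
    by (auto simp: bdd_above_def not_le)
  then show ?thesis using g(1) that by simp
qed

text \<open>
The image of a global section \<open>s\<close> is the set of fixed points of \<open>s \<circ> F\<close>. It is closed in the Hausdorff
space \<open>X\<close>, and it is open since \<open>F\<close> is locally injective; hence it is everything.
\<close>

theorem homeomorphic_map_euclidean:
  assumes "topspace X \<noteq> {}"
  shows "homeomorphic_map X euclidean F"
proof -
  obtain s where s: "is_section UNIV s" using global_section assms by blast
  have cs: "continuous_map euclidean X s" and Fs: "\<And>y. F (s y) = y"
    using s by (auto simp: is_section_def)
  have csF: "continuous_map X X (s \<circ> F)" using continuous_F cs by (rule continuous_map_compose)
  let ?A = "{p \<in> topspace X. (s \<circ> F) p = p}"
  have cl: "closedin X ?A"
    by (rule closedin_continuous_maps_eq[OF Hausdorff csF]) simp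
  have op: "openin X ?A"
  proof (subst openin_subopen, intro ballI)
    fix p assume p: "p \<in> ?A"
    obtain W where W: "openin X W" "p \<in> W" "inj_on F W" using injective_neighbourhood[of p] p by auto
    let ?O = "W \<inter> {q \<in> topspace X. (s \<circ> F) q \<in> W}"
    have "openin X ?O" by (intro openin_Int W(1) openin_continuous_map_preimage[OF csF])
    moreover have "p \<in> ?O" using p W by auto
    moreover have "?O \<subseteq> ?A" using W(3) Fs by (auto dest: inj_onD)
    ultimately show "\<exists>T. openin X T \<and> p \<in> T \<and> T \<subseteq> ?A" by blast
  qed
  have "s (F (s 0)) = s 0" by (simp add: Fs)
  then have "s 0 \<in> ?A" using section_in[OF s, of 0] by simp
  then have "?A = topspace X" using conn cl op unfolding connected_space_clopen_in by blast
  then have "homeomorphic_maps X euclidean F s"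
    unfolding homeomorphic_maps_def using continuous_F cs Fs by auto
  then show ?thesis by (rule homeomorphic_maps_imp_map)
qed

end

section \<open>From charts to the whole surface\<close>

lemma smooth_on_locally_injective:
  fixes h :: "real^2 \<Rightarrow> real^2"
  assumes S: "open S" "u \<in> S" and h: "smooth_on h S" and inj: "inj (frechet_derivative h (at u))"
  obtains r where "r > 0" "ball u r \<subseteq> S" "inj_on h (ball u r)"
proof -
  let ?D = "\<lambda>x. frechet_derivative h (at x)"
  have diff: "h differentiable (at x)" if "x \<in> S" for x
    using smooth_on_differentiable[OF h S(1) that] .
  obtain g' where g': "linear g'" "g' \<circ> ?D u = id"
    using linear_injective_left_inverse[OF linear_frechet_derivative[OF diff[OF S(2)]] inj] by blast
  have cont: "isCont (\<lambda>x. ?D x v) u" for v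
    using smooth_on_continuous_on[OF smooth_on_frechet_derivative[OF h]] S
    by (simp add: continuous_on_eq_continuous_at)
  show ?thesis
  proof (rule has_derivative_locally_injective[OF S(2,1), of g' ?D h])
    show "bounded_linear g'" using g'(1) by (simp add: linear_conv_bounded_linear)
    show "g' \<circ> ?D u = id" by (rule g'(2))
    show "(h has_derivative ?D x) (at x)" if "x \<in> S" for x
      by (rule has_frechet_derivative[OF diff[OF that]])
    fix e :: real assume e: "e > 0"
    let ?e1 = "axis 1 1 :: real^2" and ?e2 = "axis 2 1 :: real^2"
    obtain d1 where d1: "d1 > 0" "\<And>x. dist x u < d1 \<Longrightarrow> dist (?D x ?e1) (?D u ?e1) < e / 4"
      using cont[of ?e1] e unfolding continuous_at_eps_delta by (metis divide_pos_pos zero_less_numeral)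
    obtain d2 where d2: "d2 > 0" "\<And>x. dist x u < d2 \<Longrightarrow> dist (?D x ?e2) (?D u ?e2) < e / 4"
      using cont[of ?e2] e unfolding continuous_at_eps_delta by (metis divide_pos_pos zero_less_numeral)
    obtain d3 where d3: "d3 > 0" "ball u d3 \<subseteq> S" using S openE by blast
    have "onorm (\<lambda>v. ?D x v - ?D u v) < e" if x: "dist u x < min d1 (min d2 d3)" for x
    proof -
      have xS: "x \<in> S" using x d3 by auto
      have x': "dist x u < d1" "dist x u < d2" using x by (auto simp: dist_commute)
      have "norm (?D x v - ?D u v) \<le> (e / 2) * norm v" for v
      proof -
        have "?D x v - ?D u v = v$1 *\<^sub>R (?D x ?e1 - ?D u ?e1) + v$2 *\<^sub>R (?D x ?e2 - ?D u ?e2)"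
          unfolding frechet_derivative_coords[OF diff[OF xS], of v]
            frechet_derivative_coords[OF diff[OF S(2)], of v] by (simp add: algebra_simps)
        also have "norm \<dots> \<le> \<bar>v$1\<bar> * norm (?D x ?e1 - ?D u ?e1) + \<bar>v$2\<bar> * norm (?D x ?e2 - ?D u ?e2)"
          by (rule norm_triangle_le) simp
        also have "\<dots> \<le> norm v * (e / 4) + norm v * (e / 4)"
          using d1(2)[OF x'(1)] d2(2)[OF x'(2)] component_le_norm_cart[of v]
          by (intro add_mono mult_mono) (auto simp: dist_norm less_imp_le)
        finally show ?thesis by (simp add: algebra_simps)
      qed
      then have "onorm (\<lambda>v. ?D x v - ?D u v) \<le> e / 2" by (rule onorm_le)
      then show ?thesis using e by simp
    qed
    then show "\<exists>d>0. \<forall>x. dist u x < d \<longrightarrow> onorm (\<lambda>v. ?D x v - ?D u v) < e"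
      using d1(1) d2(1) d3(1) by (intro exI[of _ "min d1 (min d2 d3)"]) auto
  qed (rule that)
qed

lemma is_chartD:
  assumes "is_chart M (U, \<phi>)"
  shows "openin M U" "open (\<phi> ` U)" "inj_on \<phi> U" "homeomorphic_map (subtopology M U) (top_of_set (\<phi> ` U)) \<phi>"
proof -
  show a: "openin M U" "open (\<phi> ` U)" "homeomorphic_map (subtopology M U) (top_of_set (\<phi> ` U)) \<phi>"
    using assms by (auto simp: is_chart_def)
  have "topspace (subtopology M U) = U" using openin_subset[OF a(1)] by auto
  then show "inj_on \<phi> U" using homeomorphic_imp_injective_map[OF a(3)] by simp
qed

lemma local_param_chart:
  assumes "is_chart M (U, \<phi>)" "p \<in> U"
  shows "local_param F (U, \<phi>) (\<phi> p) = F p"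
  using is_chartD(3)[OF assms(1)] assms(2) by (simp add: local_param_def)

lemma chart_restrict:
  assumes c: "is_chart M (U, \<phi>)" and B: "open B" "B \<subseteq> \<phi> ` U"
  defines "W \<equiv> {p \<in> U. \<phi> p \<in> B}"
  shows "openin M W" "\<phi> ` W = B" "homeomorphic_map (subtopology M W) (top_of_set B) \<phi>"
proof -
  note ch = is_chartD[OF c]
  have t: "topspace (subtopology M U) = U" using openin_subset[OF ch(1)] by auto
  have "openin (subtopology M U) {p \<in> topspace (subtopology M U). \<phi> p \<in> B}"
    using homeomorphic_imp_continuous_map[OF ch(4)] B
    by (intro openin_continuous_map_preimage[of _ "top_of_set (\<phi> ` U)"]) (auto intro: open_subset)
  then show "openin M W" unfolding t W_def using ch(1) openin_trans_full by blast
  show im: "\<phi> ` W = B" using B by (auto simp: W_def)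
  have "homeomorphic_map (subtopology (subtopology M U) W) (subtopology (top_of_set (\<phi> ` U)) B) \<phi>"
    by (rule homeomorphic_map_subtopologies[OF ch(4)]) (use B im t in \<open>auto simp: W_def\<close>)
  moreover have "U \<inter> W = W" "\<phi> ` U \<inter> B = B" using B by (auto simp: W_def)
  ultimately show "homeomorphic_map (subtopology M W) (top_of_set B) \<phi>"
    by (simp add: subtopology_subtopology)
qed

lemma orthogonal_imp_parallel_cross:
  assumes "cross3 a b \<noteq> 0" "a \<bullet> n = 0" "b \<bullet> n = 0" "n \<noteq> 0"
  obtains k where "k \<noteq> 0" "n = k *\<^sub>R cross3 a b"
proof -
  have "cross3 n (cross3 a b) = 0"
    unfolding Lagrange using assms(2,3) by (simp add: inner_commute)
  then have "collinear {0, cross3 a b, n}" by (simp add: cross_eq_0 insert_commute)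
  then obtain k where "n = k *\<^sub>R cross3 a b" using assms(1,4) by (auto simp: collinear_lemma)
  then show ?thesis using that assms(4) by auto
qed

locale immersed_surface =
  fixes M :: "'a topology" and \<A> :: "'a chart set" and F :: "'a \<Rightarrow> real^3"
  assumes surface: "smooth_surface M \<A>" and immersion: "immersion \<A> F"
begin

lemma charts: "(U, \<phi>) \<in> \<A> \<Longrightarrow> is_chart M (U, \<phi>)"
  using surface by (auto simp: smooth_surface_def)

lemma obtain_chart:
  assumes "p \<in> topspace M"
  obtains U \<phi> where "(U, \<phi>) \<in> \<A>" "p \<in> U"
proof -
  have "\<Union> (fst ` \<A>) = topspace M" using surface by (simp add: smooth_surface_def)
  then have "p \<in> \<Union> (fst ` \<A>)" using assms by simp
  then show ?thesis using that by force
qed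

lemma param:
  assumes "(U, \<phi>) \<in> \<A>"
  shows "smooth_on (local_param F (U, \<phi>)) (\<phi> ` U)"
    and "\<And>x. x \<in> \<phi> ` U \<Longrightarrow> inj (frechet_derivative (local_param F (U, \<phi>)) (at x))"
  using immersion assms by (force simp: immersion_def)+

lemma continuous_map_immersion: "continuous_map M euclidean F"
proof (rule pasting_lemma[where I = \<A> and T = fst and f = "\<lambda>_. F"])
  show "openin M (fst c)" if "c \<in> \<A>" for c
    using that is_chartD(1)[OF charts] by (cases c) simp
  show "continuous_map (subtopology M (fst c)) euclidean F" if "c \<in> \<A>" for c
  proof (cases c)
    case (Pair U \<phi>)
    with that have c: "(U, \<phi>) \<in> \<A>" by simp
    note ch = is_chartD[OF charts[OF c]]
    have "continuous_map (top_of_set (\<phi> ` U)) euclidean (local_param F (U, \<phi>))"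
      using smooth_on_continuous_on[OF param(1)[OF c]] by simp
    from continuous_map_compose[OF homeomorphic_imp_continuous_map[OF ch(4)] this]
    have "continuous_map (subtopology M U) euclidean (local_param F (U, \<phi>) \<circ> \<phi>)" .
    then show ?thesis
      unfolding Pair fst_conv
      by (rule continuous_map_eq) (auto simp: local_param_chart[OF charts[OF c]])
  qed
  show "\<exists>c. c \<in> \<A> \<and> p \<in> fst c \<and> F p = F p" if "p \<in> topspace M" for p
    using obtain_chart[OF that] by (metis fst_conv)
qed auto

lemma proper_immersion_attains_min_norm:
  assumes "properly_immersed M F" "topspace M \<noteq> {}"
  obtains q where "q \<in> topspace M" "\<And>p. p \<in> topspace M \<Longrightarrow> norm (F q) \<le> norm (F p)"
proof -
  obtain p0 where p0: "p0 \<in> topspace M" using assms(2) by blast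
  let ?K = "{p \<in> topspace M. F p \<in> cball 0 (norm (F p0))}"
  have "compactin M ?K"
    using assms(1) compact_cball unfolding properly_immersed_def by blast
  then have "compact (F ` ?K)" using image_compactin[OF _ continuous_map_immersion] by fastforce
  then have "compact (norm ` F ` ?K)" by (intro compact_continuous_image continuous_intros)
  moreover have "norm ` F ` ?K \<noteq> {}" using p0 by auto
  ultimately have "\<exists>m \<in> norm ` F ` ?K. \<forall>y \<in> norm ` F ` ?K. m \<le> y"
    by (rule compact_attains_inf)
  then obtain m where m: "m \<in> norm ` F ` ?K" "\<And>y. y \<in> norm ` F ` ?K \<Longrightarrow> m \<le> y"
    by auto
  then obtain q where q: "q \<in> ?K" "m = norm (F q)" by blast
  show ?thesis
  proof (rule that[of q])
    show "norm (F q) \<le> norm (F p)" if "p \<in> topspace M" for p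
    proof (cases "p \<in> ?K")
      case True
      then show ?thesis using m(2) q(2) by blast
    next
      case False
      then show ?thesis using that q(1) by auto
    qed
  qed (use q in auto)
qed

lemma min_norm_critical:
  assumes c: "(U, \<phi>) \<in> \<A>" "q \<in> U" and min: "\<And>p. p \<in> topspace M \<Longrightarrow> norm (F q) \<le> norm (F p)"
  defines "f \<equiv> local_param F (U, \<phi>)"
  shows "f (\<phi> q) \<bullet> coord_tangent f (\<phi> q) i = 0"
proof -
  note ch = is_chartD[OF charts[OF c(1)]]
  let ?D = "frechet_derivative f (at (\<phi> q))"
  have u: "\<phi> q \<in> \<phi> ` U" using c(2) by simp
  have "f differentiable (at (\<phi> q))"
    unfolding f_def by (rule smooth_on_differentiable[OF param(1)[OF c(1)] ch(2) u])
  note D = has_frechet_derivative[OF this]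
  have "((\<lambda>x. f x \<bullet> f x) has_derivative (\<lambda>v. f (\<phi> q) \<bullet> ?D v + ?D v \<bullet> f (\<phi> q))) (at (\<phi> q))"
    by (rule has_derivative_inner[OF D D])
  moreover have "f (\<phi> q) \<bullet> f (\<phi> q) \<le> f y \<bullet> f y" if y: "y \<in> \<phi> ` U" for y
  proof -
    obtain p where p: "p \<in> U" "y = \<phi> p" using y by blast
    have "p \<in> topspace M" using p(1) openin_subset[OF ch(1)] by blast
    then show ?thesis using min[of p] p c(2)
      by (simp add: f_def local_param_chart[OF charts[OF c(1)]] norm_le)
  qed
  ultimately have "(\<lambda>v. f (\<phi> q) \<bullet> ?D v + ?D v \<bullet> f (\<phi> q)) = (\<lambda>v. 0)"
    using differential_zero_maxmin[OF u ch(2)] by blast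
  then have "f (\<phi> q) \<bullet> ?D (axis i 1) + ?D (axis i 1) \<bullet> f (\<phi> q) = 0" by metis
  then show ?thesis by (simp add: coord_tangent_def inner_commute)
qed

lemma tangent_in_plane:
  assumes c: "(U, \<phi>) \<in> \<A>" "p \<in> U" and V: "openin M V" "p \<in> V" "\<And>q. q \<in> V \<Longrightarrow> F q \<bullet> n = 0"
  shows "frechet_derivative (local_param F (U, \<phi>)) (at (\<phi> p)) v \<bullet> n = 0"
proof -
  let ?f = "local_param F (U, \<phi>)"
  note ch = is_chartD[OF charts[OF c(1)]]
  have t: "topspace (subtopology M U) = U" using openin_subset[OF ch(1)] by auto
  have "openin (subtopology M U) (U \<inter> V)" using V(1) by (auto simp: openin_subtopology)
  then have "openin (top_of_set (\<phi> ` U)) (\<phi> ` (U \<inter> V))"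
    using homeomorphic_map_openness[OF ch(4), of "U \<inter> V"] t by auto
  then have op: "open (\<phi> ` (U \<inter> V))" using ch(2) openin_open_trans by blast
  have u: "\<phi> p \<in> \<phi> ` U" "\<phi> p \<in> \<phi> ` (U \<inter> V)" using c(2) V(2) by auto
  have "frechet_derivative ?f (at (\<phi> p)) v \<bullet> n = frechet_derivative (\<lambda>x. ?f x \<bullet> n) (at (\<phi> p)) v"
    by (rule frechet_derivative_linear[OF bounded_linear_inner_left, symmetric])
      (rule smooth_on_differentiable[OF param(1)[OF c(1)] ch(2) u(1)])
  also have "frechet_derivative (\<lambda>x. ?f x \<bullet> n) (at (\<phi> p)) = frechet_derivative (\<lambda>x. 0) (at (\<phi> p))"
    by (rule frechet_derivative_cong_open[OF op u(2)])
      (use V(3) local_param_chart[OF charts[OF c(1)]] in auto)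
  finally show ?thesis by simp
qed

text \<open>
A plane through the origin that contains a piece of the surface is the tangent plane at each of its
points.
\<close>

lemma plane_unique:
  assumes V: "openin M V" "p \<in> V" and n: "n \<noteq> 0" "\<And>q. q \<in> V \<Longrightarrow> F q \<bullet> n = 0"
    and m: "m \<noteq> 0" "\<And>q. q \<in> V \<Longrightarrow> F q \<bullet> m = 0"
  shows "x \<bullet> n = 0 \<longleftrightarrow> x \<bullet> m = 0"
proof -
  have "p \<in> topspace M" using V openin_subset by blast
  then obtain U \<phi> where c: "(U, \<phi>) \<in> \<A>" "p \<in> U" using obtain_chart by blast
  let ?f = "local_param F (U, \<phi>)"
  note ch = is_chartD[OF charts[OF c(1)]]
  have u: "\<phi> p \<in> \<phi> ` U" using c(2) by simp
  let ?T = "coord_tangent ?f (\<phi> p)"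
  have cr: "cross3 (?T 1) (?T 2) \<noteq> 0"
    using unit_normal_facts(1)[OF smooth_on_differentiable[OF param(1)[OF c(1)] ch(2) u] param(2)[OF c(1) u]] .
  have t: "?T i \<bullet> n = 0" "?T i \<bullet> m = 0" for i
    unfolding coord_tangent_def using tangent_in_plane[OF c V n(2)] tangent_in_plane[OF c V m(2)] by auto
  then obtain k l where "k \<noteq> 0" "n = k *\<^sub>R cross3 (?T 1) (?T 2)" "l \<noteq> 0" "m = l *\<^sub>R cross3 (?T 1) (?T 2)"
    using orthogonal_imp_parallel_cross[OF cr t(1) t(1) n(1)] orthogonal_imp_parallel_cross[OF cr t(2) t(2) m(1)] by metis
  then show ?thesis by simp
qed

text \<open>
The points near which the surface lies in one fixed plane form an open set, and by \<open>plane_unique\<close> so do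
the points near which it lies in another one. Connectedness leaves one plane.
\<close>

lemma locally_planar_imp_planar:
  assumes conn: "connected_space M" and ne: "topspace M \<noteq> {}"
    and loc: "\<And>p. p \<in> topspace M \<Longrightarrow> \<exists>W n. openin M W \<and> p \<in> W \<and> n \<noteq> 0 \<and> (\<forall>q\<in>W. F q \<bullet> n = 0)"
  obtains n where "n \<noteq> 0" "\<And>p. p \<in> topspace M \<Longrightarrow> F p \<bullet> n = 0"
proof -
  obtain p0 where p0: "p0 \<in> topspace M" using ne by blast
  obtain W0 n where W0: "openin M W0" "p0 \<in> W0" "n \<noteq> 0" "\<And>q. q \<in> W0 \<Longrightarrow> F q \<bullet> n = 0"
    using loc[OF p0] by blast
  define T where "T = \<Union> {W. openin M W \<and> (\<forall>q\<in>W. F q \<bullet> n = 0)}"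
  have op: "openin M T" unfolding T_def by (rule openin_Union) auto
  have op': "openin M (topspace M - T)"
  proof (subst openin_subopen, intro ballI)
    fix p assume p: "p \<in> topspace M - T"
    obtain W m where W: "openin M W" "p \<in> W" "m \<noteq> 0" "\<And>q. q \<in> W \<Longrightarrow> F q \<bullet> m = 0"
      using loc[of p] p by auto
    have "r \<notin> T" if r: "r \<in> W" for r
    proof
      assume "r \<in> T"
      then obtain W' where W': "openin M W'" "r \<in> W'" "\<And>q. q \<in> W' \<Longrightarrow> F q \<bullet> n = 0"
        unfolding T_def by blast
      have "x \<bullet> m = 0 \<longleftrightarrow> x \<bullet> n = 0" for x
        by (rule plane_unique[of "W \<inter> W'" r]) (use W W' W0(3) r in \<open>auto intro: openin_Int\<close>)
      then have "p \<in> T" using W unfolding T_def by blast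
      then show False using p by blast
    qed
    then show "\<exists>V. openin M V \<and> p \<in> V \<and> V \<subseteq> topspace M - T"
      using W(1,2) openin_subset[OF W(1)] by blast
  qed
  have "closedin M T" using op op' openin_subset[OF op] by (simp add: closedin_def)
  moreover have "p0 \<in> T" using W0 unfolding T_def by blast
  ultimately have "T = topspace M" using conn op unfolding connected_space_clopen_in by blast
  then show ?thesis using that[OF W0(3)] unfolding T_def by blast
qed

text \<open>
Identify the plane with \<open>real^2\<close> by a linear isomorphism. An immersion into a space of the same
dimension is a local homeomorphism, by local injectivity and invariance of domain, so
\<open>homeomorphic_map_euclidean\<close> applies.
\<close>

lemma proper_planar_immersion_homeomorphic:
  assumes conn: "connected_space M" and ne: "topspace M \<noteq> {}" and proper: "properly_immersed M F"
    and n: "n \<noteq> 0" "\<And>p. p \<in> topspace M \<Longrightarrow> F p \<bullet> n = 0"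
  shows "homeomorphic_map M (top_of_set {x. n \<bullet> x = 0}) F"
proof -
  let ?P = "{x. n \<bullet> x = 0}"
  have FP: "F p \<in> ?P" if "p \<in> topspace M" for p using n(2)[OF that] by (simp add: inner_commute)
  have d: "dim ?P = dim (UNIV :: (real^2) set)" using n(1) by (simp add: dim_hyperplane)
  obtain L :: "real^3 \<Rightarrow> real^2" and R where L: "linear L" and R: "linear R" "range R = ?P"
    and RL: "\<And>x. x \<in> ?P \<Longrightarrow> R (L x) = x" and LR': "\<And>y. y \<in> UNIV \<Longrightarrow> L (R y) = y"
    by (rule isometries_subspaces[OF subspace_hyperplane[of n] subspace_UNIV d]) blast
  have LR: "L (R y) = y" for y using LR' by simp
  have bL: "bounded_linear L" using L by (simp add: linear_conv_bounded_linear)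
  have contR: "continuous_on A R" for A using R(1) by (rule linear_continuous_on_compose[OF continuous_on_id, simplified])
  interpret proper_local_homeo M "L \<circ> F"
  proof
    show "Hausdorff_space M" using surface by (simp add: smooth_surface_def)
    show "connected_space M" by (rule conn)
    fix K :: "(real^2) set" assume K: "compact K"
    have "{p \<in> topspace M. (L \<circ> F) p \<in> K} = {p \<in> topspace M. F p \<in> R ` K}"
      using RL[OF FP] LR by (auto simp: image_iff) metis
    then show "compactin M {p \<in> topspace M. (L \<circ> F) p \<in> K}"
      using proper compact_continuous_image[OF contR K] by (simp add: properly_immersed_def)
  next
    fix p assume "p \<in> topspace M"
    then obtain U \<phi> where c: "(U, \<phi>) \<in> \<A>" "p \<in> U" using obtain_chart by blast
    note ch = is_chartD[OF charts[OF c(1)]]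
    have UM: "U \<subseteq> topspace M" by (rule openin_subset[OF ch(1)])
    let ?f = "local_param F (U, \<phi>)"
    define h where "h = (\<lambda>x. L (?f x))"
    have u: "\<phi> p \<in> \<phi> ` U" using c(2) by simp
    have df: "?f differentiable (at (\<phi> p))"
      by (rule smooth_on_differentiable[OF param(1)[OF c(1)] ch(2) u])
    let ?D = "frechet_derivative ?f (at (\<phi> p))"
    have h: "smooth_on h (\<phi> ` U)"
      unfolding h_def by (rule smooth_on_linear[OF ch(2) bL param(1)[OF c(1)]])
    have DP: "?D v \<in> ?P" for v
      using tangent_in_plane[OF c ch(1) c(2), of n v] n(2) UM by (auto simp: inner_commute)
    have "v = v'" if "L (?D v) = L (?D v')" for v v'
    proof -
      have "?D v = ?D v'" using arg_cong[OF that, of R] unfolding RL[OF DP] .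
      then show ?thesis by (rule injD[OF param(2)[OF c(1) u]])
    qed
    then have "inj (frechet_derivative h (at (\<phi> p)))"
      unfolding h_def using frechet_derivative_linear[OF bL df] by (simp add: inj_def)
    then obtain r where r: "r > 0" "ball (\<phi> p) r \<subseteq> \<phi> ` U" "inj_on h (ball (\<phi> p) r)"
      using smooth_on_locally_injective[OF ch(2) u h] by blast
    let ?B = "ball (\<phi> p) r"
    define W where "W = {q \<in> U. \<phi> q \<in> ?B}"
    note W = chart_restrict[OF charts[OF c(1)] open_ball r(2), folded W_def]
    have ch_cont: "continuous_on ?B h" using smooth_on_continuous_on[OF h] r(2) continuous_on_subset by blast
    have "open (h ` ?B)" by (rule invariance_of_domain[OF ch_cont open_ball r(3)])
    obtain k where "homeomorphism ?B (h ` ?B) h k"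
      using invariance_of_domain_homeomorphism[OF open_ball ch_cont _ r(3)] by auto
    then have "homeomorphic_map (top_of_set ?B) (top_of_set (h ` ?B)) h"
      unfolding homeomorphic_map_maps homeomorphic_maps_def homeomorphism_def
      by (intro exI[of _ k]) auto
    from homeomorphic_map_compose[OF W(3) this]
    have hom: "homeomorphic_map (subtopology M W) (top_of_set (h ` ?B)) (h \<circ> \<phi>)" .
    have eq: "(h \<circ> \<phi>) q = (L \<circ> F) q" if "q \<in> W" for q
      using that local_param_chart[OF charts[OF c(1)]] by (simp add: W_def h_def)
    have im: "(L \<circ> F) ` W = h ` ?B"
      unfolding W(2)[symmetric] image_image using eq by (simp cong: image_cong add: image_image)
    have "homeomorphic_map (subtopology M W) (top_of_set (h ` ?B)) (L \<circ> F)"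
      by (rule homeomorphic_map_eq[OF hom]) (use eq in auto)
    then show "\<exists>W. openin M W \<and> p \<in> W \<and> open ((L \<circ> F) ` W) \<and>
      homeomorphic_map (subtopology M W) (top_of_set ((L \<circ> F) ` W)) (L \<circ> F)"
      using W(1) \<open>open (h ` ?B)\<close> c(2) r(1) unfolding im[symmetric] by (intro exI[of _ W]) (auto simp: W_def)
  qed
  have "continuous_map euclidean (top_of_set ?P) R"
    using contR[of UNIV] R(2) by (auto simp: continuous_map_in_subtopology)
  then have "homeomorphic_map euclidean (top_of_set ?P) R"
    unfolding homeomorphic_map_maps homeomorphic_maps_def
    using RL LR linear_continuous_on[OF bL] by (intro exI[of _ L]) auto
  from homeomorphic_map_compose[OF homeomorphic_map_euclidean[OF ne] this]
  have "homeomorphic_map M (top_of_set ?P) (R \<circ> (L \<circ> F))" .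
  then show ?thesis by (rule homeomorphic_map_eq) (use RL FP in auto)
qed

end

theorem theorem1p9:
  fixes M :: "'a topology" and \<A> :: "'a chart set" and F :: "'a \<Rightarrow> real^3"
  assumes "smooth_surface M \<A>" and "connected_space M" and "topspace M \<noteq> {}"
    and "immersion \<A> F"
    and "complete_surface M F"
    and "properly_immersed M F"
    and "self_expander \<A> F"
    and "nonpos_scalar_curvature \<A> F"
    and "constant_sff_norm \<A> F"
  shows "\<exists>P. subspace P \<and> dim P = 2 \<and> homeomorphic_map M (top_of_set P) F"
proof -
  interpret immersed_surface M \<A> F using assms(1,4) by unfold_locales
  have expander: "mean_curvature_vector (local_param F (U, \<phi>)) u =
      (1/2) *\<^sub>R normal_part (local_param F (U, \<phi>)) u (local_param F (U, \<phi>) u)"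
    if "(U, \<phi>) \<in> \<A>" "u \<in> \<phi> ` U" for U \<phi> u
    using assms(7) that unfolding self_expander_def by fastforce
  obtain a where a: "sff_norm (local_param F (U, \<phi>)) u = a" if "(U, \<phi>) \<in> \<A>" "u \<in> \<phi> ` U" for U \<phi> u
    using assms(9) unfolding constant_sff_norm_def by fastforce
  obtain q where q: "q \<in> topspace M" "\<And>p. p \<in> topspace M \<Longrightarrow> norm (F q) \<le> norm (F p)"
    using proper_immersion_attains_min_norm[OF assms(6,3)] by blast
  have a0: "a = 0"
  proof -
    obtain U \<phi> where c: "(U, \<phi>) \<in> \<A>" "q \<in> U" using obtain_chart[OF q(1)] by blast
    have u: "\<phi> q \<in> \<phi> ` U" using c(2) by simp
    have scal: "scalar_curvature (local_param F (U, \<phi>)) (\<phi> q) \<le> 0"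
      using assms(8) c u unfolding nonpos_scalar_curvature_def by fastforce
    show ?thesis
      by (rule expander_sff_norm_zero_at_critical_point[OF is_chartD(2)[OF charts[OF c(1)]] u param[OF c(1)]
            expander[OF c(1)] a[OF c(1)] scal min_norm_critical[OF c q(2)]])
  qed
  have loc: "\<exists>W n. openin M W \<and> p \<in> W \<and> n \<noteq> 0 \<and> (\<forall>q\<in>W. F q \<bullet> n = 0)" if p: "p \<in> topspace M" for p
  proof -
    obtain U \<phi> where c: "(U, \<phi>) \<in> \<A>" "p \<in> U" using obtain_chart[OF p] by blast
    note ch = is_chartD[OF charts[OF c(1)]]
    have u: "\<phi> p \<in> \<phi> ` U" using c(2) by simp
    let ?f = "local_param F (U, \<phi>)" and ?n = "unit_normal (local_param F (U, \<phi>)) (\<phi> p)"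
    obtain r where r: "r > 0" "ball (\<phi> p) r \<subseteq> \<phi> ` U" "\<And>x. x \<in> ball (\<phi> p) r \<Longrightarrow> ?f x \<bullet> ?n = 0"
      using flat_expander_locally_in_plane[OF ch(2) u param[OF c(1)] expander[OF c(1)] a[OF c(1), unfolded a0]]
      by blast
    have "?n \<bullet> ?n = 1"
      by (rule unit_normal_facts(2)[OF smooth_on_differentiable[OF param(1)[OF c(1)] ch(2) u] param(2)[OF c(1) u]])
    then have "?n \<noteq> 0" by auto
    moreover have "F q \<bullet> ?n = 0" if "q \<in> U" "\<phi> q \<in> ball (\<phi> p) r" for q
      using r(3)[OF that(2)] local_param_chart[OF charts[OF c(1)] that(1)] by simp
    ultimately show ?thesis
      using chart_restrict(1)[OF charts[OF c(1)] open_ball r(2)] c(2) r(1)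
      by (intro exI[of _ "{q \<in> U. \<phi> q \<in> ball (\<phi> p) r}"] exI[of _ ?n]) auto
  qed
  obtain n where n: "n \<noteq> 0" "\<And>p. p \<in> topspace M \<Longrightarrow> F p \<bullet> n = 0"
    using locally_planar_imp_planar[OF assms(2,3) loc] by blast
  show ?thesis
  proof (intro exI conjI)
    show "subspace {x. n \<bullet> x = 0}" by (rule subspace_hyperplane)
    show "dim {x. n \<bullet> x = 0} = 2" using n(1) by (simp add: dim_hyperplane)
    show "homeomorphic_map M (top_of_set {x. n \<bullet> x = 0}) F"
      by (rule proper_planar_immersion_homeomorphic[OF assms(2,3,6) n])
  qed
qed

end
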